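(* Let $A$ be a (not necessarily bounded) normal operator in a complex Hilbert space $H$ and let $B\in B(H)$. If $BA\subset AB$, then $$|\overline{BA}|=|AB|=|A|\,|B|=\overline{|B|\,|A|}.$$
   Context: $B(H)$ is the algebra of bounded everywhere defined linear operators on $H$. Operators are linear, not necessarily bounded, defined on a subspace $D(T)$ of $H$. $S\subset T$ means $D(S)\subset D(T)$ and $S=T$ on $D(S)$. Products have natural domain $D(ST)=\{x\in D(T): Tx\in D(S)\}$. $\overline{T}$ denotes the closure of a closable operator $T$. A densely defined operator $T$ is normal if it is closed and $TT^*=T^*T$. For a closed densely defined operator $T$, $|T|$ denotes the unique positive self-adjoint square root of the positive self-adjoint operator $T^*T$. Equality of operators includes equality of domains. *)

theory Defs
  imports "HOL-Analysis.Analysis"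
begin

section \<open>Complex Hilbert spaces\<close>

class scaleC =
  fixes scaleC :: "complex \<Rightarrow> 'a \<Rightarrow> 'a"  (infixr \<open>*\<^sub>C\<close> 75)

class complex_vector = real_vector + scaleC +
  assumes scaleR_scaleC: "r *\<^sub>R x = complex_of_real r *\<^sub>C x"
    and scaleC_add_right: "a *\<^sub>C (x + y) = a *\<^sub>C x + a *\<^sub>C y"
    and scaleC_add_left: "(a + b) *\<^sub>C x = a *\<^sub>C x + b *\<^sub>C x"
    and scaleC_scaleC: "a *\<^sub>C b *\<^sub>C x = (a * b) *\<^sub>C x"
    and scaleC_one: "1 *\<^sub>C x = x"

global_interpretation complex_vector:
  vector_space "scaleC :: complex \<Rightarrow> 'a \<Rightarrow> 'a::complex_vector"
  by unfold_locales
    (simp_all add: scaleC_add_right scaleC_add_left scaleC_scaleC scaleC_one)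

text \<open>The inner product is linear in its first argument.\<close>

class complex_hilbert_space = complex_vector + banach +
  fixes cinner :: "'a \<Rightarrow> 'a \<Rightarrow> complex"
  assumes cinner_commute: "cinner x y = cnj (cinner y x)"
    and cinner_add_left: "cinner (x + y) z = cinner x z + cinner y z"
    and cinner_scaleC_left: "cinner (a *\<^sub>C x) y = a * cinner x y"
    and cinner_self_nonneg: "cinner x x \<in> \<real>\<^sub>\<ge>\<^sub>0"
    and cinner_eq_zero_iff: "cinner x x = 0 \<longleftrightarrow> x = 0"
    and norm_eq_sqrt_cinner: "norm x = sqrt (Re (cinner x x))"

section \<open>Unbounded operators\<close>

text \<open>
  An operator is a partial map whose domain \<open>dom T\<close> is a complex subspace and which is linear there;
  \<open>the (T x)\<close> is its value at \<open>x \<in> dom T\<close>. Equality of partial maps includes equality of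
  domains, \<open>S \<subseteq>\<^sub>m T\<close> says that \<open>T\<close> extends \<open>S\<close>, and \<open>S \<circ>\<^sub>m T\<close> is the product on its natural
  domain \<open>{x \<in> dom T. the (T x) \<in> dom S}\<close>.
\<close>

definition linear_operator :: "('a::complex_hilbert_space \<rightharpoonup> 'a) \<Rightarrow> bool" where
  "linear_operator T \<longleftrightarrow>
     complex_vector.subspace (dom T) \<and>
     (\<forall>x\<in>dom T. \<forall>y\<in>dom T. the (T (x + y)) = the (T x) + the (T y)) \<and>
     (\<forall>c. \<forall>x\<in>dom T. the (T (c *\<^sub>C x)) = c *\<^sub>C the (T x))"

definition bounded_operator :: "('a::complex_hilbert_space \<rightharpoonup> 'a) \<Rightarrow> bool" where
  "bounded_operator T \<longleftrightarrow>
     linear_operator T \<and> dom T = UNIV \<and> (\<exists>K. \<forall>x. norm (the (T x)) \<le> K * norm x)"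

definition densely_defined :: "('a::complex_hilbert_space \<rightharpoonup> 'a) \<Rightarrow> bool" where
  "densely_defined T \<longleftrightarrow> closure (dom T) = UNIV"

definition closed_operator :: "('a::complex_hilbert_space \<rightharpoonup> 'a) \<Rightarrow> bool" where
  "closed_operator T \<longleftrightarrow> linear_operator T \<and> closed (Map.graph T)"

definition closable :: "('a::complex_hilbert_space \<rightharpoonup> 'a) \<Rightarrow> bool" where
  "closable T \<longleftrightarrow> linear_operator T \<and> single_valued (closure (Map.graph T))"

text \<open>The partial map with graph \<open>G\<close>, meaningful only for single-valued \<open>G\<close>.\<close>

definition map_of_graph :: "('a \<times> 'b) set \<Rightarrow> ('a \<rightharpoonup> 'b)" where
  "map_of_graph G = (\<lambda>x. if x \<in> Domain G then Some (THE y. (x, y) \<in> G) else None)"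

text \<open>Meaningful only for closable operators.\<close>

definition operator_closure ::
  "('a::complex_hilbert_space \<rightharpoonup> 'a) \<Rightarrow> ('a \<rightharpoonup> 'a)" where
  "operator_closure T = map_of_graph (closure (Map.graph T))"

text \<open>Meaningful only for densely defined operators, where \<open>z\<close> below is determined by \<open>y\<close>.\<close>

definition adjoint_operator ::
  "('a::complex_hilbert_space \<rightharpoonup> 'a) \<Rightarrow> ('a \<rightharpoonup> 'a)" where
  "adjoint_operator T =
     map_of_graph {(y, z). \<forall>x\<in>dom T. cinner (the (T x)) y = cinner x z}"

definition normal_operator :: "('a::complex_hilbert_space \<rightharpoonup> 'a) \<Rightarrow> bool" where
  "normal_operator T \<longleftrightarrow>
     densely_defined T \<and> closed_operator T \<and>
     T \<circ>\<^sub>m adjoint_operator T = adjoint_operator T \<circ>\<^sub>m T"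

definition self_adjoint :: "('a::complex_hilbert_space \<rightharpoonup> 'a) \<Rightarrow> bool" where
  "self_adjoint T \<longleftrightarrow>
     linear_operator T \<and> densely_defined T \<and> adjoint_operator T = T"

definition positive_operator :: "('a::complex_hilbert_space \<rightharpoonup> 'a) \<Rightarrow> bool" where
  "positive_operator T \<longleftrightarrow>
     linear_operator T \<and> (\<forall>x\<in>dom T. cinner (the (T x)) x \<in> \<real>\<^sub>\<ge>\<^sub>0)"

text \<open>Meaningful only for closed densely defined operators, where the square root exists uniquely.\<close>

definition operator_abs ::
  "('a::complex_hilbert_space \<rightharpoonup> 'a) \<Rightarrow> ('a \<rightharpoonup> 'a)" where
  "operator_abs T =
     (THE S. self_adjoint S \<and> positive_operator S \<and>
             S \<circ>\<^sub>m S = adjoint_operator T \<circ>\<^sub>m T)"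

end

theory Submission
  imports Defs
begin

text \<open>
  The heart of the matter is that \<open>B\<close> commutes with \<open>R = (1 + A\<^sup>* A)\<^sup>-\<^sup>1\<close>, a consequence of Fuglede's theorem
  that is obtained here without a spectral measure. Absolute values of unbounded operators are
  expressed by the bounded positive operators \<open>c = R\<^bsup>1/2\<^esup>\<close> and \<open>s = (1 - R)\<^bsup>1/2\<^esup>\<close>, for which
  \<open>c\<^sup>2 + s\<^sup>2 = 1\<close> and \<open>\<bar>A\<bar>\<close> has the graph \<open>{(c u, s u)}\<close>
  (\<open>operator_abs_representation\<close>). Its self-adjointness, positivity and square reduce to identities between
  \<open>c\<close> and \<open>s\<close>. The square roots are norm limits of polynomials (\<open>sqrt_exists\<close>), so whatever commutes with
  \<open>R\<close> commutes with \<open>c\<close> and \<open>s\<close>; \<open>R\<close> itself comes from projecting onto the graph of \<open>A\<close>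
  (\<open>resolvent_exists\<close>).

  Why \<open>B\<close> commutes with \<open>R\<close>: the domain of \<open>A\<close> is the range of \<open>c\<close>, with graph norm \<open>\<parallel>c\<^sup>-\<^sup>1 x\<parallel>\<close>. Since \<open>B\<close>
  commutes with \<open>A\<close>, it is bounded by \<open>\<parallel>B\<parallel>\<close> in this norm too, that is, \<open>\<parallel>c\<^sup>-\<^sup>1 B c\<parallel> \<le> \<parallel>B\<parallel>\<close>. Normality of \<open>A\<close>
  makes \<open>c\<^sup>-\<^sup>1 B c\<close> commute with \<open>A\<close> again (\<open>conjugate_exists\<close>), so \<open>\<parallel>c\<^sup>-\<^sup>k B c\<^sup>k\<parallel> \<le> \<parallel>B\<parallel>\<close> for all \<open>k\<close>. The same
  holds for \<open>B\<^sup>*\<close>, which commutes with \<open>A\<^sup>*\<close>. But a skew-adjoint operator \<open>X\<close> whose conjugates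
  \<open>c\<^sup>-\<^sup>k X c\<^sup>k\<close> stay bounded commutes with \<open>c\<^sup>2\<close> (\<open>commutes_if_conjugates_bounded\<close>), since the numerical
  radius of \<open>c\<^sup>-\<^sup>k X c\<^sup>k - c\<^sup>k X c\<^sup>-\<^sup>k\<close> would otherwise double each time \<open>k\<close> does. This applies to
  \<open>B - B\<^sup>*\<close> and \<open>\<i> (B + B\<^sup>*)\<close>.

  Then \<open>B\<close>, \<open>B\<^sup>*\<close> and hence \<open>\<bar>B\<bar> = (B\<^sup>* B)\<^bsup>1/2\<^esup>\<close> commute with \<open>c\<close> and \<open>s\<close>. For every bounded \<open>X\<close> commuting with
  \<open>c\<close> and \<open>s\<close>, the domain of \<open>\<bar>A\<bar>\<close> is a core of \<open>\<bar>A\<bar> X\<close> (\<open>commuting_product_closure\<close>), which gives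
  \<open>\<bar>A\<bar> \<bar>B\<bar>\<close> as the closure of \<open>\<bar>B\<bar> \<bar>A\<bar>\<close>, its self-adjointness, and likewise \<open>A B\<close> as the closure of
  \<open>B A\<close>. On that common core \<open>\<parallel>A B x\<parallel> = \<parallel>\<bar>A\<bar> B x\<parallel> = \<parallel>B \<bar>A\<bar> x\<parallel> = \<parallel>\<bar>B\<bar> \<bar>A\<bar> x\<parallel> = \<parallel>\<bar>A\<bar> \<bar>B\<bar> x\<parallel>\<close>, so \<open>A B\<close> and
  \<open>\<bar>A\<bar> \<bar>B\<bar>\<close> have the same domain and the same norms. Therefore \<open>(\<bar>A\<bar> \<bar>B\<bar>)\<^sup>2 = (A B)\<^sup>* A B\<close>, and
  uniqueness of the positive square root (\<open>positive_sqrt_unique\<close>) identifies \<open>\<bar>A B\<bar>\<close>.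
\<close>

section \<open>Inner products\<close>

lemma cinner_add_right:
  "cinner x (y + z) = cinner x y + cinner x (z::'a::complex_hilbert_space)"
  by (metis cinner_add_left cinner_commute complex_cnj_add)

lemma cinner_scaleC_right:
  "cinner x (a *\<^sub>C y) = cnj a * cinner x (y::'a::complex_hilbert_space)"
  by (metis cinner_commute cinner_scaleC_left complex_cnj_mult)

lemma cinner_zero_left [simp]: "cinner 0 (y::'a::complex_hilbert_space) = 0"
  using cinner_add_left[of 0 0 y] by simp

lemma cinner_zero_right [simp]: "cinner (y::'a::complex_hilbert_space) 0 = 0"
  using cinner_add_right[of y 0 0] by simp

lemma cinner_minus_left [simp]: "cinner (- x) (y::'a::complex_hilbert_space) = - cinner x y"
  using cinner_add_left[of x "- x" y] by (simp add: eq_neg_iff_add_eq_0 add.commute)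

lemma cinner_minus_right [simp]: "cinner y (- x::'a::complex_hilbert_space) = - cinner y x"
  using cinner_add_right[of y x "- x"] by (simp add: eq_neg_iff_add_eq_0 add.commute)

lemma cinner_diff_left: "cinner (x - z) (y::'a::complex_hilbert_space) = cinner x y - cinner z y"
  using cinner_add_left[of x "- z" y] by simp

lemma cinner_diff_right: "cinner y (x - z::'a::complex_hilbert_space) = cinner y x - cinner y z"
  using cinner_add_right[of y x "- z"] by simp

lemma cinner_scaleR_left: "cinner (r *\<^sub>R x) (y::'a::complex_hilbert_space) = of_real r * cinner x y"
  by (simp add: scaleR_scaleC cinner_scaleC_left)

lemma cinner_scaleR_right: "cinner y (r *\<^sub>R x::'a::complex_hilbert_space) = of_real r * cinner y x"
  by (simp add: scaleR_scaleC cinner_scaleC_right)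

lemmas cinner_simps = cinner_add_left cinner_add_right cinner_diff_left cinner_diff_right
  cinner_scaleR_left cinner_scaleR_right cinner_scaleC_left cinner_scaleC_right

lemma cinner_self: "cinner x x = of_real ((norm (x::'a::complex_hilbert_space))\<^sup>2)"
proof -
  obtain r where "r \<ge> 0" "cinner x x = of_real r"
    using cinner_self_nonneg[of x] nonneg_Reals_cases by blast
  then show ?thesis by (simp add: norm_eq_sqrt_cinner)
qed

lemma norm_add_sq:
  "(norm (x + y))\<^sup>2 = (norm x)\<^sup>2 + 2 * Re (cinner x y) + (norm (y::'a::complex_hilbert_space))\<^sup>2"
proof -
  have "complex_of_real ((norm (x + y))\<^sup>2) = cinner (x + y) (x + y)" by (simp only: cinner_self)
  also have "\<dots> = cinner x x + cinner y y + (cinner x y + cnj (cinner x y))"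
    by (simp add: cinner_simps cinner_commute[of y x])
  finally have "Re (complex_of_real ((norm (x + y))\<^sup>2)) = Re (cinner x x + cinner y y + (cinner x y + cnj (cinner x y)))"
    by simp
  then show ?thesis by (simp add: cinner_self del: of_real_power)
qed

lemma norm_diff_sq:
  "(norm (x - y))\<^sup>2 = (norm x)\<^sup>2 - 2 * Re (cinner x y) + (norm (y::'a::complex_hilbert_space))\<^sup>2"
  using norm_add_sq[of x "- y"] by simp

lemma norm_scaleC: "norm (a *\<^sub>C (x::'a::complex_hilbert_space)) = cmod a * norm x"
proof -
  have "cinner (a *\<^sub>C x) (a *\<^sub>C x) = (a * cnj a) * cinner x x"
    by (simp add: cinner_simps)
  then have "complex_of_real ((norm (a *\<^sub>C x))\<^sup>2) = of_real ((cmod a)\<^sup>2 * (norm x)\<^sup>2)"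
    by (simp only: cinner_self complex_norm_square[symmetric] of_real_mult)
  then have "(norm (a *\<^sub>C x))\<^sup>2 = (cmod a * norm x)\<^sup>2" by (simp only: of_real_eq_iff power_mult_distrib)
  then show ?thesis by simp
qed

lemma Re_cinner_le: "Re (cinner x y) \<le> norm x * norm (y::'a::complex_hilbert_space)"
proof (cases "norm x = 0 \<or> norm y = 0")
  case True
  then show ?thesis by auto
next
  case False
  have "0 \<le> (norm (norm y *\<^sub>R x - norm x *\<^sub>R y))\<^sup>2" by simp
  also have "\<dots> = 2 * (norm x * norm y) * (norm x * norm y - Re (cinner x y))"
    unfolding norm_diff_sq by (simp add: cinner_simps power2_eq_square algebra_simps)
  finally have "0 \<le> 2 * (norm x * norm y) * (norm x * norm y - Re (cinner x y))" .
  moreover have "0 < 2 * (norm x * norm y)" using False by simp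
  ultimately have "0 \<le> norm x * norm y - Re (cinner x y)" by (simp only: zero_le_mult_iff) linarith
  then show ?thesis by simp
qed

lemma norm_cinner_le: "cmod (cinner x y) \<le> norm x * norm (y::'a::complex_hilbert_space)"
proof (cases "cinner x y = 0")
  case False
  define a where "a = cnj (cinner x y) / cmod (cinner x y)"
  have a: "cmod a = 1" using False by (simp add: a_def norm_divide)
  have "cinner (a *\<^sub>C x) y = of_real (cmod (cinner x y))"
    using False by (simp add: a_def cinner_simps complex_norm_square[symmetric] power2_eq_square
        mult.commute[of "cnj _"])
  then have "cmod (cinner x y) = Re (cinner (a *\<^sub>C x) y)" by simp
  also have "\<dots> \<le> norm (a *\<^sub>C x) * norm y" by (rule Re_cinner_le)
  finally show ?thesis using a by (simp add: norm_scaleC)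
qed simp

lemma bounded_bilinear_cinner: "bounded_bilinear (cinner :: 'a::complex_hilbert_space \<Rightarrow> 'a \<Rightarrow> complex)"
  by (rule bounded_bilinear.intro)
    (auto simp: cinner_simps scaleR_conv_of_real intro!: exI[of _ 1] norm_cinner_le)

lemmas tendsto_cinner [tendsto_intros] = bounded_bilinear.tendsto[OF bounded_bilinear_cinner]
lemmas continuous_on_cinner [continuous_intros] =
  bounded_bilinear.continuous_on[OF bounded_bilinear_cinner]

lemma cinner_eqI: "(\<And>y. cinner x y = cinner z y) \<Longrightarrow> x = (z::'a::complex_hilbert_space)"
  using cinner_eq_zero_iff[of "x - z"] by (simp add: cinner_simps)

lemma cinner_eqI_right: "(\<And>y. cinner y x = cinner y z) \<Longrightarrow> x = (z::'a::complex_hilbert_space)"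
  using cinner_eq_zero_iff[of "x - z"] by (simp add: cinner_simps)

text \<open>
  The graph of an operator on \<open>H\<close> is a subspace of the Hilbert space \<open>H \<times> H\<close>, in which the
  projection theorem replaces spectral theory.
\<close>

instantiation prod :: (complex_hilbert_space, complex_hilbert_space) complex_hilbert_space
begin

definition scaleC_prod :: "complex \<Rightarrow> 'a \<times> 'b \<Rightarrow> 'a \<times> 'b" where
  "scaleC_prod a x = (a *\<^sub>C fst x, a *\<^sub>C snd x)"

definition cinner_prod :: "'a \<times> 'b \<Rightarrow> 'a \<times> 'b \<Rightarrow> complex" where
  "cinner_prod x y = cinner (fst x) (fst y) + cinner (snd x) (snd y)"

instance
proof
  fix a b :: complex and r :: real and x y z :: "'a \<times> 'b"
  show "r *\<^sub>R x = complex_of_real r *\<^sub>C x"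
    by (simp add: scaleC_prod_def scaleR_prod_def scaleR_scaleC)
  show "a *\<^sub>C (x + y) = a *\<^sub>C x + a *\<^sub>C y"
    by (simp add: scaleC_prod_def scaleC_add_right)
  show "(a + b) *\<^sub>C x = a *\<^sub>C x + b *\<^sub>C x"
    by (simp add: scaleC_prod_def scaleC_add_left)
  show "a *\<^sub>C b *\<^sub>C x = (a * b) *\<^sub>C x"
    by (simp add: scaleC_prod_def scaleC_scaleC)
  show "1 *\<^sub>C x = x"
    by (simp add: scaleC_prod_def scaleC_one)
  show "cinner x y = cnj (cinner y x)"
    by (simp add: cinner_prod_def) (metis cinner_commute)
  show "cinner (x + y) z = cinner x z + cinner y z"
    by (simp add: cinner_prod_def cinner_add_left)
  show "cinner (a *\<^sub>C x) y = a * cinner x y"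
    by (simp add: cinner_prod_def scaleC_prod_def cinner_scaleC_left algebra_simps)
  have self: "cinner x x = of_real ((norm (fst x))\<^sup>2 + (norm (snd x))\<^sup>2)" for x :: "'a \<times> 'b"
    by (simp add: cinner_prod_def cinner_self)
  show "cinner x x \<in> \<real>\<^sub>\<ge>\<^sub>0"
    unfolding self nonneg_Reals_of_real_iff by simp
  show "cinner x x = 0 \<longleftrightarrow> x = 0"
    unfolding self of_real_eq_0_iff by (simp add: sum_power2_eq_zero_iff prod_eq_iff)
  show "norm x = sqrt (Re (cinner x x))"
    unfolding self by (simp add: norm_prod_def)
qed

end

lemma cinner_Pair [simp]: "cinner (x, y) (u, v) = cinner x u + cinner y v"
  by (simp add: cinner_prod_def)

lemma scaleC_Pair [simp]: "a *\<^sub>C (x, y) = (a *\<^sub>C x, a *\<^sub>C y)"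
  by (simp add: scaleC_prod_def)

section \<open>Orthogonal projection and its consequences\<close>

lemma complex_subspaceD:
  assumes "complex_vector.subspace (M :: 'a::complex_hilbert_space set)"
  shows "0 \<in> M" "x \<in> M \<Longrightarrow> y \<in> M \<Longrightarrow> x + y \<in> M" "x \<in> M \<Longrightarrow> y \<in> M \<Longrightarrow> x - y \<in> M"
    "x \<in> M \<Longrightarrow> a *\<^sub>C x \<in> M" "x \<in> M \<Longrightarrow> r *\<^sub>R x \<in> M"
  using assms complex_vector.subspace_0 complex_vector.subspace_add complex_vector.subspace_diff
    complex_vector.subspace_scale unfolding scaleR_scaleC by blast+

text \<open>
  A sequence in \<open>M\<close> whose distances to \<open>x\<close> approach the infimum is Cauchy by the parallelogram law,
  because the midpoints of its members also lie in \<open>M\<close>; at the nearest point the first variation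
  vanishes.
\<close>

lemma orthogonal_projection:
  fixes M :: "'a::complex_hilbert_space set"
  assumes sub: "complex_vector.subspace M" and cl: "closed M"
  obtains p where "p \<in> M" "\<And>m. m \<in> M \<Longrightarrow> cinner (x - p) m = 0"
proof -
  note sub = complex_subspaceD[OF sub]
  define d where "d = (INF m\<in>M. (norm (x - m))\<^sup>2)"
  have bdd: "bdd_below ((\<lambda>m. (norm (x - m))\<^sup>2) ` M)" by (rule bdd_belowI2[of _ 0]) simp
  have d_le: "d \<le> (norm (x - m))\<^sup>2" if "m \<in> M" for m
    unfolding d_def by (rule cINF_lower[OF bdd that])
  have ex: "\<exists>m\<in>M. (norm (x - m))\<^sup>2 < d + 1 / Suc n" for n
  proof -
    have "d < d + 1 / Suc n" by simp
    then show ?thesis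
      unfolding d_def using cINF_less_iff[OF _ bdd] sub(1) by blast
  qed
  then obtain f where f: "f n \<in> M" "(norm (x - f n))\<^sup>2 < d + 1 / Suc n" for n by metis
  have par: "(norm (f m - f n))\<^sup>2 \<le> 2 / Suc m + 2 / Suc n" for m n
  proof -
    let ?h = "(1/2) *\<^sub>R (f m + f n)"
    have "(norm (x - f n + (x - f m)))\<^sup>2 + (norm (x - f n - (x - f m)))\<^sup>2
      = 2 * (norm (x - f n))\<^sup>2 + 2 * (norm (x - f m))\<^sup>2"
      using norm_add_sq[of "x - f n" "x - f m"] norm_diff_sq[of "x - f n" "x - f m"] by simp
    moreover have "x - f n + (x - f m) = 2 *\<^sub>R (x - ?h)" by (simp add: algebra_simps scaleR_2)
    then have "(norm (x - f n + (x - f m)))\<^sup>2 = 4 * (norm (x - ?h))\<^sup>2" by (simp add: power_mult_distrib)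
    moreover have "d \<le> (norm (x - ?h))\<^sup>2" by (intro d_le sub f)
    moreover have "(norm (x - f n - (x - f m)))\<^sup>2 = (norm (f m - f n))\<^sup>2" by simp
    moreover have "2 / real (Suc m) = 2 * (1 / real (Suc m))" "2 / real (Suc n) = 2 * (1 / real (Suc n))"
      by simp_all
    ultimately show ?thesis using f(2)[of m] f(2)[of n] by linarith
  qed
  have "Cauchy f"
  proof (rule metric_CauchyI)
    fix e :: real assume "0 < e"
    then obtain N where N: "4 / e\<^sup>2 < real (Suc N)" by (meson reals_Archimedean2 less_trans less_Suc_eq of_nat_less_iff)
    show "\<exists>N. \<forall>m\<ge>N. \<forall>n\<ge>N. dist (f m) (f n) < e"
    proof (intro exI allI impI)
      fix m n assume "N \<le> m" "N \<le> n"
      then have "2 / real (Suc m) \<le> 2 / real (Suc N)" "2 / real (Suc n) \<le> 2 / real (Suc N)"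
        by (auto intro!: divide_left_mono)
      with par[of m n] have "(norm (f m - f n))\<^sup>2 \<le> 4 / Suc N" by simp
      also have "\<dots> < e\<^sup>2" using N \<open>0 < e\<close> by (simp add: field_simps)
      finally show "dist (f m) (f n) < e"
        using \<open>0 < e\<close> by (simp add: dist_norm power2_less_imp_less)
    qed
  qed
  then obtain p where p: "f \<longlonglongrightarrow> p" using Cauchy_convergent_iff convergent_def by blast
  have pM: "p \<in> M" using closed_sequentially[OF cl f(1) p] .
  have d_ge: "(norm (x - p))\<^sup>2 \<le> d"
  proof (rule LIMSEQ_le)
    show "(\<lambda>n. (norm (x - f n))\<^sup>2) \<longlonglongrightarrow> (norm (x - p))\<^sup>2" by (intro tendsto_intros p)
    have "(\<lambda>n. 1 / real (Suc n)) \<longlonglongrightarrow> 0" using LIMSEQ_inverse_real_of_nat by (simp add: inverse_eq_divide)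
    from tendsto_add[OF tendsto_const this] show "(\<lambda>n. d + 1 / real (Suc n)) \<longlonglongrightarrow> d" by simp
    show "\<exists>N. \<forall>n\<ge>N. (norm (x - f n))\<^sup>2 \<le> d + 1 / real (Suc n)" using f(2) less_imp_le by blast
  qed
  have min: "(norm (x - p))\<^sup>2 \<le> (norm (x - m))\<^sup>2" if "m \<in> M" for m
    using d_ge d_le[OF that] by (rule order_trans)
  have "cinner (x - p) m = 0" if m: "m \<in> M" for m
  proof (cases "m = 0")
    case False
    \<comment> \<open>the point of the complex line through \<open>p\<close> in direction \<open>m\<close> that is nearest to \<open>x\<close>\<close>
    define a where "a = cinner (x - p) m / cinner m m"
    have cm: "cinner m m \<noteq> 0" using False by (simp add: cinner_eq_zero_iff)
    have "(norm (x - p))\<^sup>2 \<le> (norm (x - (p + a *\<^sub>C m)))\<^sup>2" by (intro min sub pM m)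
    moreover have "x - (p + a *\<^sub>C m) = (x - p) - a *\<^sub>C m" by simp
    ultimately have "2 * Re (cinner (x - p) (a *\<^sub>C m)) \<le> (norm (a *\<^sub>C m))\<^sup>2"
      using norm_diff_sq[of "x - p" "a *\<^sub>C m"] by simp
    moreover have "cinner (x - p) (a *\<^sub>C m) = of_real ((norm (a *\<^sub>C m))\<^sup>2)"
      unfolding cinner_self[symmetric] using cm by (simp add: cinner_simps a_def)
    ultimately have "norm (a *\<^sub>C m) = 0" by (simp del: norm_eq_zero)
    then show ?thesis using False cm by (simp add: norm_scaleC a_def)
  qed simp
  then show ?thesis using that pM by blast
qed

lemma closure_complex_subspace:
  assumes "complex_vector.subspace (M :: 'a::complex_hilbert_space set)"
  shows "complex_vector.subspace (closure M)"
proof -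
  note sub = complex_subspaceD[OF assms]
  have bl: "bounded_linear (\<lambda>x::'a. a *\<^sub>C x)" for a
    by (rule bounded_linear_intro[where K = "cmod a"])
      (auto simp: scaleC_add_right scaleR_scaleC scaleC_scaleC mult.commute norm_scaleC)
  show ?thesis
  proof (rule complex_vector.subspaceI)
    show "0 \<in> closure M" using sub(1) closure_subset by blast
    fix x y assume "x \<in> closure M" "y \<in> closure M"
    then obtain f g where "\<And>n. f n \<in> M" "f \<longlonglongrightarrow> x" "\<And>n. g n \<in> M" "g \<longlonglongrightarrow> y"
      unfolding closure_sequential by blast
    then show "x + y \<in> closure M"
      unfolding closure_sequential by (intro exI[of _ "\<lambda>n. f n + g n"]) (auto intro: sub tendsto_add)
  next
    fix a x assume "x \<in> closure M"
    then obtain f where "\<And>n. f n \<in> M" "f \<longlonglongrightarrow> x" unfolding closure_sequential by blast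
    then show "a *\<^sub>C x \<in> closure M"
      unfolding closure_sequential
      by (intro exI[of _ "\<lambda>n. a *\<^sub>C f n"]) (auto intro: sub bounded_linear.tendsto[OF bl])
  qed
qed

lemma dense_subspaceI:
  fixes M :: "'a::complex_hilbert_space set"
  assumes M: "complex_vector.subspace M" and N: "complex_vector.subspace N"
    and "M \<subseteq> N" "closed N"
    and orth: "\<And>x. x \<in> N \<Longrightarrow> (\<And>m. m \<in> M \<Longrightarrow> cinner x m = 0) \<Longrightarrow> x = 0"
  shows "closure M = N"
proof
  show sub: "closure M \<subseteq> N" using assms closure_minimal by blast
  show "N \<subseteq> closure M"
  proof
    fix x assume x: "x \<in> N"
    obtain p where p: "p \<in> closure M" "\<And>m. m \<in> closure M \<Longrightarrow> cinner (x - p) m = 0"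
      using orthogonal_projection[OF closure_complex_subspace[OF M] closed_closure] by metis
    have "x - p = 0"
      using p(2) closure_subset x p(1) sub complex_subspaceD(3)[OF N] by (intro orth) blast+
    then show "x \<in> closure M" using p(1) by simp
  qed
qed

text \<open>
  The type of \<open>X\<close> makes it only real linear. Having an adjoint forces complex linearity, because the inner
  product is complex linear.
\<close>

definition adj :: "('a::complex_hilbert_space \<Rightarrow>\<^sub>L 'a) \<Rightarrow> ('a \<Rightarrow>\<^sub>L 'a) \<Rightarrow> bool" where
  "adj X Y \<longleftrightarrow> (\<forall>x y. cinner (X x) y = cinner x (Y y))"

lemma adjD: "adj X Y \<Longrightarrow> cinner (X x) y = cinner x (Y y)"
  by (simp add: adj_def)

lemma adj_sym: "adj X Y \<Longrightarrow> adj Y X"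
  unfolding adj_def by (metis cinner_commute)

lemma adj_scaleC:
  assumes "adj X Y" shows "X (a *\<^sub>C x) = a *\<^sub>C X x"
  by (rule cinner_eqI) (simp add: adjD[OF assms] cinner_simps)

text \<open>
  If \<open>f x0 \<noteq> 0\<close>, the component \<open>e\<close> of \<open>x0\<close> orthogonal to the kernel spans the orthogonal complement of
  the kernel, since \<open>f x e - f e x\<close> is in the kernel for all \<open>x\<close>.
\<close>

lemma riesz_representation:
  fixes f :: "'a::complex_hilbert_space \<Rightarrow> complex"
  assumes f: "bounded_linear f" and fC: "\<And>a x. f (a *\<^sub>C x) = a * f x"
  obtains z where "\<And>x. f x = cinner x z"
proof (cases "\<forall>x. f x = 0")
  case True
  then show ?thesis using that[of 0] by simp
next
  case False
  then obtain x0 where x0: "f x0 \<noteq> 0" by blast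
  interpret f: bounded_linear f by (rule f)
  let ?K = "{x. f x = 0}"
  have sub: "complex_vector.subspace ?K"
    by (rule complex_vector.subspaceI) (auto simp: f.zero f.add fC)
  have cl: "closed ?K"
    using continuous_closed_vimage[of "{0}" f] by (simp add: vimage_def f.isCont)
  obtain p where "p \<in> ?K" and "\<And>m. m \<in> ?K \<Longrightarrow> cinner (x0 - p) m = 0"
    by (rule orthogonal_projection[OF sub cl, of x0]) blast
  then have p: "f p = 0" "\<And>m. f m = 0 \<Longrightarrow> cinner (x0 - p) m = 0" by simp_all
  define e where "e = x0 - p"
  have fe: "f e \<noteq> 0" using x0 p(1) by (simp add: e_def f.diff)
  then have ee: "cinner e e \<noteq> 0" by (auto simp: cinner_eq_zero_iff f.zero)
  have "f x = cinner x (cnj (f e / cinner e e) *\<^sub>C e)" for x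
  proof -
    have "cinner e (f x *\<^sub>C e - f e *\<^sub>C x) = 0"
      unfolding e_def by (rule p(2)) (simp add: f.diff fC)
    then have "cinner (f x *\<^sub>C e - f e *\<^sub>C x) e = 0" by (metis cinner_commute complex_cnj_zero)
    then have "f x * cinner e e = f e * cinner x e" by (simp only: cinner_simps) simp
    then show ?thesis using ee by (simp add: cinner_scaleC_right eq_divide_eq)
  qed
  then show ?thesis using that by blast
qed

lemma adj_exists:
  fixes X :: "'a::complex_hilbert_space \<Rightarrow>\<^sub>L 'a"
  assumes "\<And>a x. X (a *\<^sub>C x) = a *\<^sub>C X x"
  obtains Y where "adj X Y"
proof -
  have "\<exists>z. \<forall>x. cinner (X x) y = cinner x z" for y
  proof -
    have "bounded_linear (\<lambda>x. cinner (X x) y)"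
      by (intro bounded_linear_compose[OF bounded_bilinear.bounded_linear_left[OF bounded_bilinear_cinner]]
          blinfun.bounded_linear_right)
    then show ?thesis
      by (rule riesz_representation) (auto simp: assms cinner_simps)
  qed
  then obtain Y where Y: "\<And>x y. cinner (X x) y = cinner x (Y y)" by metis
  have "bounded_linear Y"
  proof (rule bounded_linear_intro[where K = "norm X"])
    show "Y (x + y) = Y x + Y y" for x y
      by (rule cinner_eqI_right) (simp add: Y[symmetric] cinner_simps)
    show "Y (r *\<^sub>R x) = r *\<^sub>R Y x" for r x
      by (rule cinner_eqI_right) (simp add: Y[symmetric] cinner_simps)
    show "norm (Y y) \<le> norm y * norm X" for y
    proof (cases "Y y = 0")
      case False
      have "(norm (Y y))\<^sup>2 = Re (cinner (X (Y y)) y)" by (simp add: Y cinner_self)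
      also have "\<dots> \<le> norm (X (Y y)) * norm y" by (rule Re_cinner_le)
      also have "\<dots> \<le> norm X * norm (Y y) * norm y" by (intro mult_right_mono norm_blinfun) simp
      finally show ?thesis using False by (simp add: power2_eq_square mult.commute mult.left_commute)
    qed simp
  qed
  then have "adj X (Blinfun Y)" by (simp add: adj_def Y bounded_linear_Blinfun_apply)
  then show ?thesis using that by blast
qed

section \<open>Positive bounded operators and their square roots\<close>

lemma Re_cinner_commute: "Re (cinner x y) = Re (cinner y (x::'a::complex_hilbert_space))"
  by (metis cinner_commute cnj.sel(1))

lemma Re_cinner_self: "Re (cinner x x) = (norm (x::'a::complex_hilbert_space))\<^sup>2"
  by (simp add: cinner_self del: of_real_power)

lemma norm_sq_adj: "adj X X' \<Longrightarrow> (norm (X x))\<^sup>2 = Re (cinner x (X' (X x)))"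
  by (simp add: adjD[symmetric] Re_cinner_self)

lemma adj_add: "adj X X' \<Longrightarrow> adj Y Y' \<Longrightarrow> adj (X + Y) (X' + Y')"
  by (simp add: adj_def blinfun.add_left cinner_simps)

lemma adj_diff: "adj X X' \<Longrightarrow> adj Y Y' \<Longrightarrow> adj (X - Y) (X' - Y')"
  by (simp add: adj_def blinfun.diff_left cinner_simps)

lemma adj_scaleR: "adj X X' \<Longrightarrow> adj (r *\<^sub>R X) (r *\<^sub>R X')"
  by (simp add: adj_def blinfun.scaleR_left cinner_simps)

lemma adj_compose: "adj X X' \<Longrightarrow> adj Y Y' \<Longrightarrow> adj (X o\<^sub>L Y) (Y' o\<^sub>L X')"
  by (simp add: adj_def)

lemma adj_id: "adj id_blinfun id_blinfun"
  by (simp add: adj_def)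

lemma adj_zero: "adj 0 0"
  by (simp add: adj_def)

lemma tendsto_blinfun_apply: "(F \<longlongrightarrow> L) net \<Longrightarrow> ((\<lambda>n. blinfun_apply (F n) x) \<longlongrightarrow> blinfun_apply L x) net"
  by (intro tendsto_intros)

lemma adj_limit:
  assumes "\<And>n. adj (F n) (F' n)" "F \<longlonglongrightarrow> L" "F' \<longlonglongrightarrow> L'"
  shows "adj L L'"
  unfolding adj_def
proof (intro allI)
  fix x y
  have "(\<lambda>n. cinner (F n x) y) \<longlonglongrightarrow> cinner (L x) y" "(\<lambda>n. cinner x (F' n y)) \<longlonglongrightarrow> cinner x (L' y)"
    by (intro tendsto_intros assms)+
  then show "cinner (L x) y = cinner x (L' y)"
    using LIMSEQ_unique adjD[OF assms(1)] by simp
qed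

definition nonneg_op :: "('a::complex_hilbert_space \<Rightarrow>\<^sub>L 'a) \<Rightarrow> bool" where
  "nonneg_op X \<longleftrightarrow> adj X X \<and> (\<forall>x. 0 \<le> Re (cinner (X x) x))"

lemma nonneg_opD: "nonneg_op X \<Longrightarrow> adj X X" "nonneg_op X \<Longrightarrow> 0 \<le> Re (cinner (X x) x)"
  by (auto simp: nonneg_op_def)

lemma nonneg_op_cinner:
  assumes "nonneg_op X" shows "cinner (X x) x \<in> \<real>\<^sub>\<ge>\<^sub>0"
proof -
  have "cinner (X x) x = cnj (cinner (X x) x)"
    using adjD[OF nonneg_opD(1)[OF assms], of x x] cinner_commute by metis
  then have "Im (cinner (X x) x) = 0" by (simp add: complex_eq_iff)
  then show ?thesis using nonneg_opD(2)[OF assms] by (simp add: complex_nonneg_Reals_iff)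
qed

text \<open>The quadratic form is minimal at \<open>y\<close>, so its derivative along \<open>V y\<close>, which is \<open>2 \<parallel>V y\<parallel>\<^sup>2\<close>, is zero.\<close>

lemma nonneg_op_null:
  assumes V: "nonneg_op V" and y: "Re (cinner (V y) y) = 0"
  shows "V y = 0"
proof -
  define z where "z = V y"
  define a where "a = Re (cinner (V z) z)"
  define s where "s = (norm z)\<^sup>2 / (a + 1)"
  have a: "a \<ge> 0" using nonneg_opD(2)[OF V] by (simp add: a_def)
  have "cinner (V z) y = cinner z z"
    using adjD[OF nonneg_opD(1)[OF V], of z y] by (simp add: z_def)
  then have "Re (cinner (V (y - s *\<^sub>R z)) (y - s *\<^sub>R z)) = s * s * a - 2 * s * (norm z)\<^sup>2"
    using y by (simp add: blinfun.bilinear_simps cinner_simps cinner_self a_def z_def[symmetric]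
        algebra_simps)
  then have "0 \<le> s * (s * a - 2 * (norm z)\<^sup>2)"
    using nonneg_opD(2)[OF V, of "y - s *\<^sub>R z"] by (simp add: algebra_simps)
  moreover have "s * a \<le> (norm z)\<^sup>2" using a by (simp add: s_def field_simps)
  moreover have "s > 0" if "z \<noteq> 0" using a that by (simp add: s_def)
  ultimately have "z = 0"
    by (cases "z = 0") (simp_all add: zero_le_mult_iff, smt (verit) zero_less_power2 norm_eq_zero)
  then show ?thesis by (simp add: z_def)
qed

lemma blinfun_graph_subspace: "subspace {z. snd z = blinfun_apply X (fst z)}"
  by (auto simp: subspace_def blinfun.bilinear_simps)

lemma blinfun_graph_closed: "closed {z. snd z = blinfun_apply X (fst z)}"
  by (intro closed_Collect_eq continuous_intros)

text \<open>
  This stands for \<open>c\<close> being a function of \<open>Q\<close>. With \<open>K\<close> the graph of a closed operator, bounded or not, it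
  says that \<open>c\<close> commutes with that operator if \<open>Q\<close> does.
\<close>

definition subordinate :: "('a::complex_hilbert_space \<Rightarrow>\<^sub>L 'a) \<Rightarrow> ('a \<Rightarrow>\<^sub>L 'a) \<Rightarrow> bool" where
  "subordinate c Q \<longleftrightarrow> (\<forall>K. subspace K \<longrightarrow> closed K \<longrightarrow>
     (\<forall>x y. (x, y) \<in> K \<longrightarrow> (Q x, Q y) \<in> K) \<longrightarrow> (\<forall>x y. (x, y) \<in> K \<longrightarrow> (c x, c y) \<in> K))"

lemma subordinateD:
  assumes "subordinate c Q" "subspace K" "closed K"
    and "\<And>x y. (x, y) \<in> K \<Longrightarrow> (Q x, Q y) \<in> K" and "(x, y) \<in> K"
  shows "(c x, c y) \<in> K"
  using assms unfolding subordinate_def by blast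

lemma subordinate_commutes:
  assumes "subordinate c Q" and "\<And>x. blinfun_apply X (Q x) = Q (X x)"
  shows "X (c x) = c (X x)"
  using subordinateD[OF assms(1) blinfun_graph_subspace[of X] blinfun_graph_closed, of x "X x"] assms(2)
  by simp

text \<open>
  With \<open>P = 1 - Q\<close>, an operator \<open>1 - L\<close> squares to \<open>Q\<close> iff \<open>L = (P + L\<^sup>2) / 2\<close>. Iterating the right-hand
  side from 0 gives polynomials in \<open>P\<close> with nonnegative coefficients, so their increments are
  dominated by those of the scalar iteration for \<open>P = 1\<close>, which increases to 1. Being a norm limit of
  polynomials in \<open>Q\<close>, the root \<open>1 - L\<close> is subordinate to \<open>Q\<close>.
\<close>

lemma sqrt_exists:
  fixes Q :: "'a::complex_hilbert_space \<Rightarrow>\<^sub>L 'a"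
  assumes Q: "adj Q Q" and nQ: "norm (id_blinfun - Q) \<le> 1"
  obtains c where "nonneg_op c" "c o\<^sub>L c = Q" "norm (id_blinfun - c) \<le> 1"
    "subordinate c Q"
proof -
  define P where "P = id_blinfun - Q"
  have P: "norm P \<le> 1" "adj P P" using nQ adj_diff[OF adj_id Q] by (simp_all add: P_def)
  define Y where "Y = rec_nat (0 :: 'a \<Rightarrow>\<^sub>L 'a) (\<lambda>_ Z. (1/2) *\<^sub>R (P + (Z o\<^sub>L Z)))"
  define y where "y = rec_nat (0 :: real) (\<lambda>_ z. (1 + z * z) / 2)"
  have Y: "Y 0 = 0" "Y (Suc n) = (1/2) *\<^sub>R (P + (Y n o\<^sub>L Y n))" for n by (simp_all add: Y_def)
  have y: "y 0 = 0" "y (Suc n) = (1 + y n * y n) / 2" for n by (simp_all add: y_def)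
  have y1: "0 \<le> y n \<and> y n \<le> 1" for n
  proof (induction n)
    case (Suc n)
    then have "y n * y n \<le> 1 * 1" by (intro mult_mono) auto
    then show ?case by (simp add: y)
  qed (simp add: y)
  have nY: "norm (Y n) \<le> y n" for n
  proof (induction n)
    case (Suc n)
    have "norm (Y n o\<^sub>L Y n) \<le> y n * y n"
      using Suc y1[of n] by (intro order_trans[OF norm_blinfun_compose] mult_mono) auto
    then have "norm (P + (Y n o\<^sub>L Y n)) \<le> 1 + y n * y n"
      using P(1) norm_triangle_mono by blast
    then show ?case by (simp add: Y y)
  qed (simp add: Y y)
  have PY: "P (Y n x) = Y n (P x)" for n x
    by (induction n arbitrary: x) (simp_all add: Y blinfun.bilinear_simps)
  have YY: "Y (Suc n) (Y n x) = Y n (Y (Suc n) x)" for n x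
    by (simp add: Y blinfun.bilinear_simps PY)
  have step: "norm (Y (Suc n) - Y n) \<le> y (Suc n) - y n" for n
  proof (induction n)
    case 0
    then show ?case using P(1) by (simp add: Y y)
  next
    case (Suc n)
    have "Y (Suc (Suc n)) - Y (Suc n)
      = (1/2) *\<^sub>R ((P + (Y (Suc n) o\<^sub>L Y (Suc n))) - (P + (Y n o\<^sub>L Y n)))"
      by (simp only: Y(2)[of "Suc n"] Y(2)[of n] scaleR_right_diff_distrib)
    also have "(P + (Y (Suc n) o\<^sub>L Y (Suc n))) - (P + (Y n o\<^sub>L Y n))
      = (Y (Suc n) + Y n) o\<^sub>L (Y (Suc n) - Y n)"
      by (rule blinfun_eqI) (simp add: blinfun.bilinear_simps YY)
    finally have "Y (Suc (Suc n)) - Y (Suc n) = (1/2) *\<^sub>R ((Y (Suc n) + Y n) o\<^sub>L (Y (Suc n) - Y n))" .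
    then have "norm (Y (Suc (Suc n)) - Y (Suc n)) \<le> (1/2) * (norm (Y (Suc n) + Y n) * norm (Y (Suc n) - Y n))"
      by (simp add: norm_blinfun_compose)
    also have "\<dots> \<le> (1/2) * ((y (Suc n) + y n) * (y (Suc n) - y n))"
      using nY[of n] nY[of "Suc n"] Suc y1[of n] y1[of "Suc n"]
      by (intro mult_left_mono mult_mono) (auto intro: norm_triangle_mono)
    also have "\<dots> = y (Suc (Suc n)) - y (Suc n)"
      by (simp add: y(2)[of "Suc n"] y(2)[of n] field_simps)
    finally show ?case .
  qed
  have diff: "norm (Y (n + k) - Y n) \<le> y (n + k) - y n" for n k
  proof (induction k)
    case (Suc k)
    have "Y (n + Suc k) - Y n = (Y (Suc (n + k)) - Y (n + k)) + (Y (n + k) - Y n)" by simp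
    also have "norm \<dots> \<le> (y (Suc (n + k)) - y (n + k)) + (y (n + k) - y n)"
      by (intro norm_triangle_mono step Suc)
    finally show ?case by simp
  qed simp
  have "incseq y"
    by (rule incseq_SucI) (use order_trans[OF norm_ge_zero step] in simp)
  moreover have "\<forall>i. y i \<le> 1" using y1 by blast
  ultimately have "convergent y" using incseq_convergent convergentI by metis
  then have "Cauchy y" by (rule convergent_Cauchy)
  have "Cauchy Y"
  proof (rule metric_CauchyI)
    fix e :: real assume "0 < e"
    then obtain N where N: "\<And>m n. m \<ge> N \<Longrightarrow> n \<ge> N \<Longrightarrow> dist (y m) (y n) < e"
      using metric_CauchyD[OF \<open>Cauchy y\<close>] by blast
    have "dist (Y (n + k)) (Y n) < e" if "n \<ge> N" for n k
      using diff[of n k] N[of "n + k" n] that by (simp add: dist_norm)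
    then have "dist (Y m) (Y n) < e" if "m \<ge> N" "n \<ge> N" for m n
      using that by (cases "m \<ge> n") (metis le_Suc_ex, metis le_Suc_ex dist_commute nat_le_linear)
    then show "\<exists>N. \<forall>m\<ge>N. \<forall>n\<ge>N. dist (Y m) (Y n) < e" by blast
  qed
  then obtain L where L: "Y \<longlonglongrightarrow> L" using Cauchy_convergent_iff convergent_def by blast
  define c where "c = id_blinfun - L"
  have LL: "L = (1/2) *\<^sub>R (P + (L o\<^sub>L L))"
  proof (rule LIMSEQ_unique)
    show "(\<lambda>n. Y (Suc n)) \<longlonglongrightarrow> L" using L by (rule LIMSEQ_Suc)
    show "(\<lambda>n. Y (Suc n)) \<longlonglongrightarrow> (1/2) *\<^sub>R (P + (L o\<^sub>L L))"
      unfolding Y by (intro tendsto_intros L bounded_bilinear.tendsto[OF bounded_bilinear_blinfun_compose])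
  qed
  have nL: "norm L \<le> 1"
    by (rule LIMSEQ_le_const2[OF tendsto_norm[OF L]]) (use nY y1 order_trans in blast)
  have "adj (Y n) (Y n)" for n
    by (induction n) (auto simp: Y intro: adj_zero adj_scaleR adj_add adj_compose P)
  then have aL: "adj L L" using L L by (rule adj_limit)
  have "nonneg_op c"
    unfolding nonneg_op_def
  proof (intro conjI allI)
    show "adj c c" unfolding c_def by (intro adj_diff adj_id aL)
    fix x
    have "Re (cinner (L x) x) \<le> norm (L x) * norm x" by (rule Re_cinner_le)
    also have "\<dots> \<le> (1 * norm x) * norm x"
      using nL by (intro mult_right_mono order_trans[OF norm_blinfun]) auto
    finally show "0 \<le> Re (cinner (c x) x)"
      by (simp add: c_def blinfun.bilinear_simps cinner_simps cinner_self power2_eq_square)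
  qed
  moreover have "c o\<^sub>L c = Q"
  proof (rule blinfun_eqI)
    fix x
    have "2 *\<^sub>R L x = P x + L (L x)"
      using arg_cong[OF LL, of "\<lambda>Z. 2 *\<^sub>R blinfun_apply Z x"] by (simp add: blinfun.bilinear_simps)
    then show "(c o\<^sub>L c) x = Q x"
      by (simp add: c_def P_def blinfun.bilinear_simps scaleR_2 algebra_simps)
  qed
  moreover
  have "(c u, c v) \<in> K"
    if K: "subspace K" "closed K" "\<And>x y. (x, y) \<in> K \<Longrightarrow> (Q x, Q y) \<in> K" and uv: "(u, v) \<in> K" for K u v
  proof -
    have PK: "(P x, P y) \<in> K" if "(x, y) \<in> K" for x y
      using subspace_diff[OF K(1) that K(3)[OF that]] by (simp add: P_def blinfun.bilinear_simps)
    have "(Y n x, Y n y) \<in> K" if "(x, y) \<in> K" for n x y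
      using that
    proof (induction n arbitrary: x y)
      case 0
      then show ?case using subspace_0[OF K(1)] by (simp add: Y zero_prod_def)
    next
      case (Suc n)
      then have "(1/2) *\<^sub>R ((P x, P y) + (Y n (Y n x), Y n (Y n y))) \<in> K"
        by (intro subspace_scale subspace_add K PK) auto
      then show ?case by (simp add: Y blinfun.bilinear_simps)
    qed
    then have "(Y n u, Y n v) \<in> K" for n using uv by blast
    moreover have "(\<lambda>n. (Y n u, Y n v)) \<longlonglongrightarrow> (L u, L v)"
      by (intro tendsto_Pair tendsto_blinfun_apply L)
    ultimately have "(L u, L v) \<in> K" by (rule closed_sequentially[OF K(2)])
    with subspace_diff[OF K(1) uv this] show ?thesis by (simp add: c_def blinfun.bilinear_simps)
  qed
  then have "subordinate c Q" by (auto simp: subordinate_def)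
  ultimately show ?thesis using that nL by (simp add: c_def)
qed

text \<open>
  A positive square root \<open>V\<close> of \<open>Q\<close> commutes with \<open>Q\<close>, hence with the root \<open>c\<close> just constructed. Then
  \<open>(V + c) (V - c) = 0\<close>, so both forms vanish on the range of \<open>V - c\<close>.
\<close>

lemma nonneg_sqrt_unique:
  assumes V: "nonneg_op V" and W: "nonneg_op W" and VW: "V o\<^sub>L V = W o\<^sub>L W"
    and n: "norm (id_blinfun - (V o\<^sub>L V)) \<le> 1"
  shows "V = W"
proof -
  obtain c where c: "nonneg_op c" "c o\<^sub>L c = V o\<^sub>L V"
    and cK: "subordinate c (V o\<^sub>L V)"
    using sqrt_exists[OF adj_compose[OF nonneg_opD(1)[OF V] nonneg_opD(1)[OF V]] n] by metis
  have eq: "U = c" if U: "nonneg_op U" and UV: "U o\<^sub>L U = V o\<^sub>L V" for U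
  proof (rule blinfun_eqI)
    fix x
    have UVx: "V (V x) = U (U x)" "c (c x) = U (U x)" for x
      using UV c(2) by (metis blinfun_apply_blinfun_compose)+
    have Uc: "U (c x) = c (U x)" for x
      by (rule subordinate_commutes[OF cK]) (simp_all add: UVx)
    let ?y = "U x - c x"
    have "U ?y + c ?y = 0"
      by (simp add: blinfun.bilinear_simps Uc UVx)
    then have "Re (cinner (U ?y) ?y) + Re (cinner (c ?y) ?y) = 0"
      by (metis cinner_add_left cinner_zero_left plus_complex.sel(1) zero_complex.sel(1))
    then have "Re (cinner (U ?y) ?y) = 0" "Re (cinner (c ?y) ?y) = 0"
      using nonneg_opD(2)[OF U, of ?y] nonneg_opD(2)[OF c(1), of ?y] by linarith+
    then have "U ?y = 0" "c ?y = 0" using nonneg_op_null U c(1) by blast+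
    then have "cinner ?y ?y = 0"
      using adjD[OF nonneg_opD(1)[OF U], of x ?y] adjD[OF nonneg_opD(1)[OF c(1)], of x ?y]
      by (simp add: cinner_diff_left)
    then show "U x = c x" by (simp add: cinner_eq_zero_iff)
  qed
  show ?thesis using eq[OF V refl] eq[OF W VW[symmetric]] by simp
qed

text \<open>
  If \<open>X = c\<^sup>2\<close> with \<open>c\<close> subordinate to \<open>X\<close>, then \<open>\<langle>X Y x, x\<rangle> = \<langle>c Y x, c x\<rangle> = \<langle>Y c x, c x\<rangle>\<close>.
\<close>

lemma nonneg_compose:
  assumes X: "nonneg_op X" and Y: "nonneg_op Y" and nX: "norm (id_blinfun - X) \<le> 1"
    and XY: "\<And>x. X (Y x) = Y (X x)"
  shows "nonneg_op (X o\<^sub>L Y)"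
  unfolding nonneg_op_def
proof (intro conjI allI)
  show "adj (X o\<^sub>L Y) (X o\<^sub>L Y)"
    using adjD[OF nonneg_opD(1)[OF X]] adjD[OF nonneg_opD(1)[OF Y]] by (simp add: adj_def XY)
  obtain c where c: "nonneg_op c" "c o\<^sub>L c = X"
    and cK: "subordinate c X"
    using sqrt_exists[OF nonneg_opD(1)[OF X] nX] by metis
  fix x
  have "cinner ((X o\<^sub>L Y) x) x = cinner (c (Y x)) (c x)"
    using adjD[OF nonneg_opD(1)[OF c(1)], of "c (Y x)"] c(2) by (metis blinfun_apply_blinfun_compose)
  also have "c (Y x) = Y (c x)" using subordinate_commutes[OF cK, of Y x] XY by simp
  finally show "0 \<le> Re (cinner ((X o\<^sub>L Y) x) x)" using nonneg_opD(2)[OF Y] by simp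
qed

text \<open>
  The last conclusion says that \<open>\<bar>X\<bar>\<close> commutes with every \<open>Z\<close> that commutes with \<open>X\<^sup>* X\<close>. The constant \<open>k\<close>
  brings \<open>X\<^sup>* X / k\<^sup>2\<close> within distance 1 of the identity, where the square root has been constructed.
\<close>

lemma bounded_abs_exists:
  fixes X :: "'a::complex_hilbert_space \<Rightarrow>\<^sub>L 'a"
  assumes XX': "adj X X'"
  obtains b where "nonneg_op b" "b o\<^sub>L b = X' o\<^sub>L X"
    "\<And>(Z :: 'a \<Rightarrow>\<^sub>L 'a) x. (\<And>x. Z (X' (X x)) = X' (X (Z x))) \<Longrightarrow> Z (b x) = b (Z x)"
proof -
  define k where "k = 1 + norm X'"
  have k: "k > 0" by (simp add: k_def add_pos_nonneg)
  let ?Q = "(1 / k\<^sup>2) *\<^sub>R (X' o\<^sub>L X)"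
  have "adj ?Q ?Q" by (rule adj_scaleR[OF adj_compose[OF adj_sym[OF XX'] XX']])
  moreover have "norm (id_blinfun - ?Q) \<le> 1"
  proof (rule norm_blinfun_bound)
    fix x
    let ?u = "(1 / k) *\<^sub>R X x" and ?v = "?Q x"
    have "norm (X' (X x)) \<le> k * norm (X x)"
      by (rule order_trans[OF norm_blinfun]) (simp add: k_def mult_right_mono)
    then have "norm ?v \<le> norm ?u"
      using k by (simp add: blinfun.bilinear_simps field_simps power2_eq_square)
    then have "(norm ?v)\<^sup>2 \<le> (norm ?u)\<^sup>2" by simp
    moreover have "Re (cinner x ?v) = (norm ?u)\<^sup>2"
      by (simp add: blinfun.bilinear_simps cinner_simps norm_sq_adj[OF XX'] power_mult_distrib power_divide)
    ultimately have "(norm (x - ?v))\<^sup>2 \<le> (norm x)\<^sup>2"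
      using norm_diff_sq[of x ?v] zero_le_power2[of "norm ?u"] by linarith
    then have "norm (x - ?v) \<le> norm x" by (rule power2_le_imp_le) simp
    then show "norm ((id_blinfun - ?Q) x) \<le> 1 * norm x" by (simp add: blinfun.bilinear_simps)
  qed simp
  ultimately obtain c where c: "nonneg_op c" "c o\<^sub>L c = ?Q"
    and cK: "subordinate c ?Q"
    using sqrt_exists by metis
  show ?thesis
  proof (rule that[of "k *\<^sub>R c"])
    show "nonneg_op (k *\<^sub>R c)"
      using k nonneg_opD[OF c(1)]
      by (auto simp: nonneg_op_def blinfun.bilinear_simps cinner_simps intro: adj_scaleR)
    have "(k *\<^sub>R c) o\<^sub>L (k *\<^sub>R c) = k\<^sup>2 *\<^sub>R (c o\<^sub>L c)"
      by (intro blinfun_eqI) (simp add: blinfun.bilinear_simps power2_eq_square)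
    then show "(k *\<^sub>R c) o\<^sub>L (k *\<^sub>R c) = X' o\<^sub>L X" using k by (simp add: c(2))
    fix Z :: "'a \<Rightarrow>\<^sub>L 'a" and x assume "\<And>x. Z (X' (X x)) = X' (X (Z x))"
    then have "Z (c x) = c (Z x)"
      by (intro subordinate_commutes[OF cK]) (simp_all add: blinfun.bilinear_simps)
    then show "Z ((k *\<^sub>R c) x) = (k *\<^sub>R c) (Z x)" by (simp add: blinfun.bilinear_simps)
  qed
qed

section \<open>Conjugation of self-adjoint operators\<close>

text \<open>
  For self-adjoint \<open>T\<close> the numbers \<open>\<parallel>T\<^sup>n u\<parallel>\<close> are log-convex in \<open>n\<close>, so that \<open>\<parallel>T u\<parallel> > q \<parallel>u\<parallel>\<close> would make
  them grow faster than \<open>q\<^sup>n\<close>. For \<open>u = C x\<close> this is impossible, as \<open>T\<^sup>n C x = C T'\<^sup>n x\<close>. Thus among all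
  operators conjugate to it by \<open>C\<close>, a self-adjoint one has the least norm (M. G. Krein).
\<close>

lemma symmetrizable_norm_le:
  fixes T T' C :: "'a::complex_hilbert_space \<Rightarrow>\<^sub>L 'a"
  assumes T: "adj T T" and C: "closure (range C) = UNIV" and TC: "\<And>x. T (C x) = C (T' x)"
    and T': "\<And>x. norm (T' x) \<le> q * norm x" and q: "q \<ge> 0"
  shows "norm (T u) \<le> q * norm u"
proof -
  have "norm (T u) \<le> q * norm u" if "u \<in> range C" for u
  proof (rule ccontr)
    assume neg: "\<not> norm (T u) \<le> q * norm u"
    obtain x where x: "u = C x" using \<open>u \<in> range C\<close> by blast
    define a where "a n = norm (((blinfun_apply T) ^^ n) u)" for n
    have logconv: "(a (Suc n))\<^sup>2 \<le> a n * a (Suc (Suc n))" for n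
    proof -
      let ?v = "((blinfun_apply T) ^^ n) u"
      have "(norm (T ?v))\<^sup>2 = Re (cinner ?v (T (T ?v)))"
        by (rule norm_sq_adj[OF T])
      also have "\<dots> \<le> norm ?v * norm (T (T ?v))" by (rule Re_cinner_le)
      finally show ?thesis by (simp add: a_def)
    qed
    have a01: "a 0 = norm u" "a (Suc 0) = norm (T u)" by (simp_all add: a_def)
    have a0: "a 0 > 0" using neg a01 by (cases "u = 0") (auto simp: blinfun.zero_right)
    define r where "r = a (Suc 0) / a 0"
    have r: "r > q" using neg a0 by (simp add: r_def a01 field_simps)
    have grow: "a (Suc n) \<ge> r * a n \<and> a n > 0" for n
    proof (induction n)
      case 0
      then show ?case using a0 by (simp add: r_def)
    next
      case (Suc n)
      have pos: "a (Suc n) > 0" using Suc r q by (smt (verit) mult_pos_pos)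
      have "(r * a n) * a (Suc n) \<le> a (Suc n) * a (Suc n)" using Suc pos by (intro mult_right_mono) auto
      also have "\<dots> \<le> a n * a (Suc (Suc n))" using logconv[of n] by (simp add: power2_eq_square)
      finally have "a n * (r * a (Suc n)) \<le> a n * a (Suc (Suc n))" by (simp add: mult_ac)
      then show ?case using Suc pos by simp
    qed
    have lower: "a n \<ge> r ^ n * a 0" for n
    proof (induction n)
      case (Suc n)
      have "r ^ Suc n * a 0 = r * (r ^ n * a 0)" by simp
      also have "\<dots> \<le> r * a n" using Suc r q by (intro mult_left_mono) auto
      also have "\<dots> \<le> a (Suc n)" using grow by blast
      finally show ?case .
    qed simp
    have pow: "((blinfun_apply T) ^^ n) (C x) = C (((blinfun_apply T') ^^ n) x)" for n
      by (induction n) (simp_all add: TC)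
    have pow': "norm (((blinfun_apply T') ^^ n) x) \<le> q ^ n * norm x" for n
    proof (induction n)
      case (Suc n)
      have "norm (((blinfun_apply T') ^^ Suc n) x) \<le> q * norm (((blinfun_apply T') ^^ n) x)"
        using T' by simp
      also have "\<dots> \<le> q * (q ^ n * norm x)" using Suc q by (rule mult_left_mono)
      finally show ?case by (simp add: mult.assoc)
    qed simp
    have upper: "a n \<le> norm C * norm x * q ^ n" for n
    proof -
      have "a n \<le> norm C * norm (((blinfun_apply T') ^^ n) x)"
        unfolding a_def x pow by (rule norm_blinfun)
      also have "\<dots> \<le> norm C * (q ^ n * norm x)" using pow' by (rule mult_left_mono) simp
      finally show ?thesis by (simp add: mult_ac)
    qed
    have "q > 0" using upper[of "Suc 0"] grow[of "Suc 0"] q by (cases "q = 0") auto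
    then have "r / q > 1" using r by simp
    then obtain n where n: "norm C * norm x / a 0 < (r / q) ^ n" using real_arch_pow by blast
    have "norm C * norm x * q ^ n < r ^ n * a 0"
      using n a0 \<open>q > 0\<close> by (simp add: power_divide field_simps)
    with lower[of n] upper[of n] show False by simp
  qed
  then have "range C \<subseteq> {u. norm (T u) \<le> q * norm u}" by blast
  moreover have "closed {u. norm (T u) \<le> q * norm u}"
    by (intro closed_Collect_le continuous_intros)
  ultimately have "closure (range C) \<subseteq> {u. norm (T u) \<le> q * norm u}" by (rule closure_minimal)
  then show ?thesis using C by blast
qed

text \<open>
  The preceding bound for \<open>1 + h T\<close>, to first order in the real number \<open>h\<close>: up to \<open>O(h\<^sup>2)\<close>, the norm of
  \<open>(1 + h T') x\<close> is governed by \<open>h Re \<langle>T' x, x\<rangle>\<close> alone.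
\<close>

lemma symmetrizable_numerical_range:
  fixes T T' C :: "'a::complex_hilbert_space \<Rightarrow>\<^sub>L 'a"
  assumes T: "adj T T" and C: "closure (range C) = UNIV" and TC: "\<And>x. T (C x) = C (T' x)"
    and T': "\<And>x. \<bar>Re (cinner (T' x) x)\<bar> \<le> m * (norm x)\<^sup>2" and m: "m \<ge> 0"
  shows "\<bar>Re (cinner (T u) u)\<bar> \<le> m * (norm u)\<^sup>2"
proof -
  define k where "k = (norm T')\<^sup>2"
  have sq: "(norm (x + h *\<^sub>R Z x))\<^sup>2 = (norm x)\<^sup>2 + 2 * h * Re (cinner (Z x) x) + h\<^sup>2 * (norm (Z x))\<^sup>2"
    for x h and Z :: "'a \<Rightarrow>\<^sub>L 'a"
    by (simp add: norm_add_sq cinner_simps power_mult_distrib Re_cinner_commute[of x])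
  have main: "2 * h * Re (cinner (T u) u) \<le> (2 * \<bar>h\<bar> * m + h\<^sup>2 * k) * (norm u)\<^sup>2" for h
  proof -
    define q where "q = sqrt (1 + 2 * \<bar>h\<bar> * m + h\<^sup>2 * k)"
    have nn: "0 \<le> 1 + 2 * \<bar>h\<bar> * m + h\<^sup>2 * k" using m by (simp add: k_def add_nonneg_nonneg)
    then have q2: "q\<^sup>2 = 1 + 2 * \<bar>h\<bar> * m + h\<^sup>2 * k" "q \<ge> 0" by (simp_all add: q_def)
    have "norm ((id_blinfun + h *\<^sub>R T) u) \<le> q * norm u"
    proof (rule symmetrizable_norm_le[OF _ C _ _ q2(2)])
      show "adj (id_blinfun + h *\<^sub>R T) (id_blinfun + h *\<^sub>R T)" by (intro adj_add adj_id adj_scaleR T)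
      show "(id_blinfun + h *\<^sub>R T) (C x) = C ((id_blinfun + h *\<^sub>R T') x)" for x
        by (simp add: blinfun.bilinear_simps TC)
      show "norm ((id_blinfun + h *\<^sub>R T') x) \<le> q * norm x" for x
      proof -
        have "(norm (T' x))\<^sup>2 \<le> (norm T' * norm x)\<^sup>2" by (intro power_mono norm_blinfun) simp
        then have "h\<^sup>2 * (norm (T' x))\<^sup>2 \<le> h\<^sup>2 * (k * (norm x)\<^sup>2)"
          by (intro mult_left_mono) (simp_all add: k_def power_mult_distrib)
        moreover have "2 * h * Re (cinner (T' x) x) \<le> 2 * \<bar>h\<bar> * (m * (norm x)\<^sup>2)"
        proof -
          have "h * Re (cinner (T' x) x) \<le> \<bar>h\<bar> * \<bar>Re (cinner (T' x) x)\<bar>"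
            by (metis abs_ge_self abs_mult)
          also have "\<dots> \<le> \<bar>h\<bar> * (m * (norm x)\<^sup>2)" using T' by (intro mult_left_mono) auto
          finally show ?thesis by simp
        qed
        ultimately have "(norm (x + h *\<^sub>R T' x))\<^sup>2 \<le> (q * norm x)\<^sup>2"
          unfolding sq power_mult_distrib q2(1) distrib_right by linarith
        then have "norm (x + h *\<^sub>R T' x) \<le> q * norm x"
          by (rule power2_le_imp_le) (simp add: q2(2))
        then show ?thesis by (simp add: blinfun.bilinear_simps)
      qed
    qed
    then have "(norm (u + h *\<^sub>R T u))\<^sup>2 \<le> (q * norm u)\<^sup>2"
      by (intro power_mono) (simp_all add: blinfun.bilinear_simps)
    then have "(norm u)\<^sup>2 + 2 * h * Re (cinner (T u) u) + h\<^sup>2 * (norm (T u))\<^sup>2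
      \<le> (1 + 2 * \<bar>h\<bar> * m + h\<^sup>2 * k) * (norm u)\<^sup>2"
      unfolding sq power_mult_distrib q2 .
    moreover have "0 \<le> h\<^sup>2 * (norm (T u))\<^sup>2" by simp
    ultimately show ?thesis unfolding distrib_right by linarith
  qed
  have "s * Re (cinner (T u) u) \<le> m * (norm u)\<^sup>2" if s: "s = 1 \<or> s = -1" for s
  proof (rule field_le_epsilon)
    fix e :: real assume e: "e > 0"
    define w where "w = k * (norm u)\<^sup>2"
    have w: "w \<ge> 0" by (simp add: w_def k_def)
    define t where "t = e / (w + 1)"
    have t: "t > 0" "t * w \<le> e" using e w by (simp_all add: t_def field_simps)
    have "\<bar>s * t\<bar> = t" "(s * t)\<^sup>2 = t * t" using s t by (auto simp: power2_eq_square)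
    with main[of "s * t"]
    have "2 * (s * t) * Re (cinner (T u) u) \<le> (2 * t * m + t * t * k) * (norm u)\<^sup>2"
      by metis
    then have "2 * t * (s * Re (cinner (T u) u)) \<le> 2 * t * (m * (norm u)\<^sup>2 + t * w / 2)"
      by (simp add: w_def algebra_simps)
    then have "s * Re (cinner (T u) u) \<le> m * (norm u)\<^sup>2 + t * w / 2"
      using t(1) by simp
    then show "s * Re (cinner (T u) u) \<le> m * (norm u)\<^sup>2 + e" using t e w by linarith
  qed
  from this[of 1] this[of "-1"] show ?thesis by simp
qed

lemma range_complex_subspace:
  assumes "\<And>a x. blinfun_apply X (a *\<^sub>C x) = a *\<^sub>C X x"
  shows "complex_vector.subspace (range (blinfun_apply X))"
  by (rule complex_vector.subspaceI)
    (auto simp: image_iff blinfun.add_right[symmetric] assms[symmetric] intro: exI[of _ 0])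

lemma self_adjoint_dense_range:
  assumes C: "adj C C" and inj: "\<And>x. C x = 0 \<Longrightarrow> x = 0"
  shows "closure (range (blinfun_apply C)) = UNIV"
proof (rule dense_subspaceI)
  show "complex_vector.subspace (range (blinfun_apply C))"
    by (rule range_complex_subspace[OF adj_scaleC[OF C]])
  show "complex_vector.subspace (UNIV :: 'a set)" by (rule complex_vector.subspace_UNIV)
  fix x assume "\<And>m. m \<in> range (blinfun_apply C) \<Longrightarrow> cinner x m = 0"
  then have "cinner (C x) y = 0" for y by (simp add: adjD[OF C])
  then have "C x = 0" using cinner_eq_zero_iff by blast
  then show "x = 0" by (rule inj)
qed auto

text \<open>
  Here \<open>C n\<close> is the power of \<open>C 0\<close> with exponent \<open>2\<^sup>n\<close>, and the operator \<open>M\<close> of the last hypothesis, called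
  \<open>M n\<close> in the proof, is \<open>C\<^sup>-\<^sup>1 X C\<close> for \<open>C = C n\<close>. As \<open>X\<close> is skew-adjoint, the adjoint of \<open>M n\<close> is
  \<open>- C X C\<^sup>-\<^sup>1\<close>. So conjugation by \<open>C n\<close> turns the self-adjoint \<open>Y n = M n + (M n)\<^sup>*\<close> into \<open>M (n + 1) - X\<close>,
  whose real part is half of \<open>Y (n + 1)\<close>. By the preceding lemma the numerical radius of \<open>Y (n + 1)\<close> is
  at least twice that of \<open>Y n\<close>. As all of them are bounded by \<open>2 K\<close>, \<open>Y 0 = 0\<close>, which for \<open>C = C 0\<close> means
  \<open>C\<^sup>-\<^sup>1 X C = C X C\<^sup>-\<^sup>1\<close>.
\<close>

lemma commutes_if_conjugates_bounded:
  fixes C :: "nat \<Rightarrow> ('a::complex_hilbert_space \<Rightarrow>\<^sub>L 'a)"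
  assumes X: "adj X (- X)"
    and C: "\<And>n. adj (C n) (C n)" and inj: "\<And>n x. C n x = 0 \<Longrightarrow> x = 0"
    and CC: "\<And>n x. C (Suc n) x = C n (C n x)"
    and XC: "\<And>n. \<exists>M. norm M \<le> K \<and> (\<forall>x. C n (blinfun_apply M x) = X (C n x))"
  shows "X (C 0 (C 0 x)) = C 0 (C 0 (X x))"
proof -
  obtain M where nM: "\<And>n. norm (M n) \<le> K" and M: "\<And>n x. C n (blinfun_apply (M n) x) = X (C n x)"
    using XC by metis
  have injC: "x = y" if "C n x = C n y" for n x y
    using inj[of n "x - y"] that by (simp add: blinfun.diff_right)
  have Mlin: "M n (a *\<^sub>C x) = a *\<^sub>C M n x" for n a x
    by (rule injC[of n]) (simp add: M adj_scaleC[OF C] adj_scaleC[OF X])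
  have "\<forall>n. \<exists>N. adj (M n) N" using Mlin adj_exists by metis
  then obtain N where N: "\<And>n. adj (M n) (N n)" by metis
  have NC: "N n (C n x) = - C n (X x)" for n x
  proof (rule cinner_eqI_right)
    fix y
    have "cinner y (N n (C n x)) = cinner (C n (M n y)) x"
      by (simp add: adjD[OF N, symmetric] adjD[OF C])
    also have "\<dots> = cinner y (- C n (X x))"
      by (simp only: M adjD[OF X] adjD[OF C] blinfun.minus_left blinfun.minus_right)
    finally show "cinner y (N n (C n x)) = cinner y (- C n (X x))" .
  qed
  have CM: "C n (M (Suc n) x) = M n (C n x)" for n x
    by (rule injC[of n]) (simp only: M CC[symmetric])
  define Y where "Y n = M n + N n" for n
  have Y: "adj (Y n) (Y n)" for n
    unfolding Y_def using adj_add[OF N adj_sym[OF N]] by (simp add: add.commute)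
  have YRe: "Re (cinner (Y n x) x) = 2 * Re (cinner (M n x) x)" for n x
    using adjD[OF adj_sym[OF N], of n x x] Re_cinner_commute[of x "M n x"]
    by (simp add: Y_def blinfun.bilinear_simps cinner_simps)
  have step: "\<bar>Re (cinner (Y n u) u)\<bar> \<le> m / 2 * (norm u)\<^sup>2"
    if m: "\<And>x. \<bar>Re (cinner (Y (Suc n) x) x)\<bar> \<le> m * (norm x)\<^sup>2" "m \<ge> 0" for n m u
  proof (rule symmetrizable_numerical_range[OF Y])
    show "closure (range (C n)) = UNIV" by (rule self_adjoint_dense_range[OF C inj])
    show "Y n (C n x) = C n ((M (Suc n) - X) x)" for x
      by (simp add: Y_def blinfun.bilinear_simps NC CM)
    have "Re (cinner (X x) x) = 0" for x
    proof -
      have "cinner (X x) x = - cinner x (X x)"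
        unfolding adjD[OF X] by (simp add: blinfun.minus_left)
      then have "Re (cinner (X x) x) = - Re (cinner x (X x))" by simp
      then show ?thesis unfolding Re_cinner_commute[of x] by linarith
    qed
    then show "\<bar>Re (cinner ((M (Suc n) - X) x) x)\<bar> \<le> m / 2 * (norm x)\<^sup>2" for x
      using m(1)[of x] by (simp add: blinfun.bilinear_simps cinner_simps YRe)
    show "0 \<le> m / 2" using m(2) by simp
  qed
  have K: "K \<ge> 0" using nM norm_ge_zero order_trans by blast
  have top: "\<bar>Re (cinner (Y n x) x)\<bar> \<le> 2 * K * (norm x)\<^sup>2" for n x
  proof -
    have "\<bar>Re (cinner (M n x) x)\<bar> \<le> norm (M n x) * norm x"
      using abs_Re_le_cmod norm_cinner_le order_trans by blast
    also have "\<dots> \<le> (K * norm x) * norm x"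
      using nM[of n] by (intro mult_right_mono order_trans[OF norm_blinfun]) auto
    finally show ?thesis by (simp add: YRe abs_mult power2_eq_square)
  qed
  have iter: "\<bar>Re (cinner (Y n x) x)\<bar> \<le> 2 * K / 2 ^ j * (norm x)\<^sup>2" for n j x
  proof (induction j arbitrary: n x)
    case 0
    then show ?case using top by simp
  next
    case (Suc j)
    have "\<bar>Re (cinner (Y n x) x)\<bar> \<le> 2 * K / 2 ^ j / 2 * (norm x)\<^sup>2"
      using Suc K by (intro step) auto
    then show ?case by (simp add: field_simps)
  qed
  have Y0: "Re (cinner (Y 0 x) x) = 0" for x
  proof (rule ccontr)
    assume neg: "Re (cinner (Y 0 x) x) \<noteq> 0"
    obtain j where "2 * K * (norm x)\<^sup>2 / \<bar>Re (cinner (Y 0 x) x)\<bar> < 2 ^ j"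
      using real_arch_pow[of 2] by auto
    then have "2 * K / 2 ^ j * (norm x)\<^sup>2 < \<bar>Re (cinner (Y 0 x) x)\<bar>"
      using neg by (simp add: field_simps)
    with iter[of 0 x j] show False by simp
  qed
  then have "nonneg_op (Y 0)" using Y by (simp add: nonneg_op_def)
  then have "M 0 x + N 0 x = 0" for x
    using nonneg_op_null Y0 by (metis Y_def blinfun.add_left)
  then have *: "N 0 x = - M 0 x" for x by (metis add.inverse_unique)
  have "X (C 0 (C 0 x)) = C 0 (M 0 (C 0 x))" by (simp add: M)
  also have "M 0 (C 0 x) = C 0 (X x)" using NC[of 0 x] * by simp
  finally show ?thesis .
qed

section \<open>Unbounded operators\<close>

lemma map_eqI: "(\<And>x y. f x = Some y \<longleftrightarrow> g x = Some y) \<Longrightarrow> f = g"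
  by (metis ext not_None_eq)

lemma in_graph_iff: "(x, y) \<in> Map.graph T \<longleftrightarrow> T x = Some y"
  by (simp add: Map.graph_def)

lemma linear_operatorD:
  assumes T: "linear_operator T"
  shows "T x = Some a \<Longrightarrow> T y = Some b \<Longrightarrow> T (x + y) = Some (a + b)"
    and "T x = Some a \<Longrightarrow> T (k *\<^sub>C x) = Some (k *\<^sub>C a)"
    and "T 0 = Some 0"
    and "T x = Some a \<Longrightarrow> T y = Some b \<Longrightarrow> T (x - y) = Some (a - b)"
    and "T x = Some a \<Longrightarrow> T (r *\<^sub>R x) = Some (r *\<^sub>R a)"
proof -
  note sub = T[unfolded linear_operator_def, THEN conjunct1]
  have dom: "x \<in> dom T \<longleftrightarrow> (\<exists>a. T x = Some a)" for x by (simp add: dom_def)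
  show add: "T (x + y) = Some (a + b)" if "T x = Some a" "T y = Some b" for x y a b
  proof -
    have "x + y \<in> dom T" using complex_subspaceD(2)[OF sub] that dom by blast
    then obtain e where e: "T (x + y) = Some e" using dom by blast
    have "\<forall>x\<in>dom T. \<forall>y\<in>dom T. the (T (x + y)) = the (T x) + the (T y)"
      using T unfolding linear_operator_def by blast
    then show ?thesis using that e dom by force
  qed
  show scale: "T (k *\<^sub>C x) = Some (k *\<^sub>C a)" if "T x = Some a" for x a k
  proof -
    have "k *\<^sub>C x \<in> dom T" using complex_subspaceD(4)[OF sub] that dom by blast
    then obtain e where e: "T (k *\<^sub>C x) = Some e" using dom by blast
    have "\<forall>c. \<forall>x\<in>dom T. the (T (c *\<^sub>C x)) = c *\<^sub>C the (T x)"
      using T unfolding linear_operator_def by blast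
    then have "the (T (k *\<^sub>C x)) = k *\<^sub>C the (T x)" using domI[where m = T, OF that] by blast
    then show ?thesis using that e by simp
  qed
  show scaleR: "T (r *\<^sub>R x) = Some (r *\<^sub>R a)" if "T x = Some a" for x a r
    using scale[OF that, of "of_real r"] by (simp only: scaleR_scaleC)
  show "T (x - y) = Some (a - b)" if "T x = Some a" "T y = Some b" for x y a b
    using add[OF that(1) scaleR[OF that(2), of "-1"]] by simp
  obtain a where "T 0 = Some a" using complex_subspaceD(1)[OF sub] dom by blast
  from scaleR[OF this, of 0] show "T 0 = Some 0" by simp
qed

lemma linear_operatorI:
  assumes "T 0 = Some 0" "\<And>x y a b. T x = Some a \<Longrightarrow> T y = Some b \<Longrightarrow> T (x + y) = Some (a + b)"
    "\<And>x a k. T x = Some a \<Longrightarrow> T (k *\<^sub>C x) = Some (k *\<^sub>C a)"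
  shows "linear_operator T"
  unfolding linear_operator_def
proof (intro conjI allI ballI)
  show "complex_vector.subspace (dom T)"
    using assms by (intro complex_vector.subspaceI) (auto simp: dom_def)
qed (auto simp: assms)

lemma graph_subspace:
  assumes "linear_operator T"
  shows "complex_vector.subspace (Map.graph T)" "subspace (Map.graph T)"
  using linear_operatorD[OF assms]
  by (auto simp: in_graph_iff subspace_def zero_prod_def intro!: complex_vector.subspaceI)

lemma linear_operator_comp:
  assumes "linear_operator S" "linear_operator T" shows "linear_operator (S \<circ>\<^sub>m T)"
proof (rule linear_operatorI)
  note S = linear_operatorD[OF assms(1)] and T = linear_operatorD[OF assms(2)]
  show "(S \<circ>\<^sub>m T) 0 = Some 0" using S(3) T(3) by (simp add: map_comp_Some_iff)
  fix x y a b k assume "(S \<circ>\<^sub>m T) x = Some a"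
  then obtain p where p: "T x = Some p" "S p = Some a" by (auto simp: map_comp_Some_iff)
  show "(S \<circ>\<^sub>m T) (k *\<^sub>C x) = Some (k *\<^sub>C a)"
    using T(2)[OF p(1)] S(2)[OF p(2)] by (auto simp: map_comp_Some_iff)
  assume "(S \<circ>\<^sub>m T) y = Some b"
  then obtain q where q: "T y = Some q" "S q = Some b" by (auto simp: map_comp_Some_iff)
  show "(S \<circ>\<^sub>m T) (x + y) = Some (a + b)"
    using T(1)[OF p(1) q(1)] S(1)[OF p(2) q(2)] by (auto simp: map_comp_Some_iff)
qed

lemma linear_operator_blinfun:
  assumes "\<And>a x. blinfun_apply X (a *\<^sub>C x) = a *\<^sub>C X x"
  shows "linear_operator (\<lambda>x. Some (X x))"
  by (rule linear_operatorI) (auto simp: assms blinfun.bilinear_simps)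

lemma closed_operator_limit:
  assumes "closed_operator T" "\<And>n. T (f n) = Some (g n)" "f \<longlonglongrightarrow> x" "g \<longlonglongrightarrow> y"
  shows "T x = Some y"
proof -
  have "closed (Map.graph T)" using assms(1) by (simp add: closed_operator_def)
  moreover have "(f n, g n) \<in> Map.graph T" for n by (simp add: in_graph_iff assms(2))
  moreover have "(\<lambda>n. (f n, g n)) \<longlonglongrightarrow> (x, y)" by (intro tendsto_Pair assms)
  ultimately have "(x, y) \<in> Map.graph T" by (rule closed_sequentially)
  then show ?thesis by (simp add: in_graph_iff)
qed

lemma map_of_graph_Some:
  assumes "single_valued G"
  shows "map_of_graph G x = Some y \<longleftrightarrow> (x, y) \<in> G"
proof -
  have "(THE y. (x, y) \<in> G) = y'" if "(x, y') \<in> G" for y'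
    using that single_valuedD[OF assms] by blast
  then show ?thesis by (auto simp: map_of_graph_def Domain_iff)
qed

lemma operator_closure_eq:
  assumes "closure (Map.graph T) = Map.graph S"
  shows "operator_closure T = S"
proof (rule map_eqI)
  have "single_valued (Map.graph S)" by (auto simp: single_valued_def in_graph_iff)
  then show "operator_closure T x = Some y \<longleftrightarrow> S x = Some y" for x y
    unfolding operator_closure_def assms by (simp add: map_of_graph_Some in_graph_iff)
qed

lemma closableI:
  assumes "linear_operator T" "closure (Map.graph T) = Map.graph S"
  shows "closable T"
  using assms by (auto simp: closable_def single_valued_def in_graph_iff)

lemma densely_defined_cinner_eqI:
  assumes "densely_defined T" "\<And>x a. T x = Some a \<Longrightarrow> cinner x y = cinner x z"
  shows "y = z"
proof (rule cinner_eqI_right)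
  have "dom T \<subseteq> {x. cinner x y = cinner x z}" using assms(2) by (auto simp: dom_def)
  moreover have "closed {x. cinner x y = cinner x z}"
    by (intro closed_Collect_eq continuous_intros)
  ultimately have "closure (dom T) \<subseteq> {x. cinner x y = cinner x z}" by (rule closure_minimal)
  then show "cinner x y = cinner x z" for x using assms(1) by (auto simp: densely_defined_def)
qed

lemma adjoint_Some:
  assumes "densely_defined T"
  shows "adjoint_operator T y = Some z \<longleftrightarrow> (\<forall>x a. T x = Some a \<longrightarrow> cinner a y = cinner x z)"
proof -
  have "single_valued {(y, z). \<forall>x\<in>dom T. cinner (the (T x)) y = cinner x z}"
    unfolding single_valued_def
    by (auto intro!: densely_defined_cinner_eqI[OF assms])
  then show ?thesis
    unfolding adjoint_operator_def by (auto simp: map_of_graph_Some dom_def)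
qed

lemma adjoint_closed_operator:
  assumes T: "densely_defined T"
  shows "closed_operator (adjoint_operator T)"
  unfolding closed_operator_def
proof
  show "linear_operator (adjoint_operator T)"
    by (rule linear_operatorI) (auto simp: adjoint_Some[OF T] cinner_simps)
  have "Map.graph (adjoint_operator T) =
    (\<Inter>p\<in>Map.graph T. {q. cinner (snd p) (fst q) = cinner (fst p) (snd q)})"
  proof (rule set_eqI)
    show "q \<in> Map.graph (adjoint_operator T) \<longleftrightarrow>
      q \<in> (\<Inter>p\<in>Map.graph T. {q. cinner (snd p) (fst q) = cinner (fst p) (snd q)})" for q
      unfolding INT_iff mem_Collect_eq Ball_def split_paired_All
      by (cases q) (simp add: in_graph_iff adjoint_Some[OF T])
  qed
  also have "closed \<dots>"
    by (intro closed_INT ballI closed_Collect_eq continuous_intros)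
  finally show "closed (Map.graph (adjoint_operator T))" .
qed

lemma self_adjointD:
  assumes "self_adjoint S"
  shows "closed_operator S" "densely_defined S" "linear_operator S" "adjoint_operator S = S"
    and "S x = Some a \<Longrightarrow> S y = Some b \<Longrightarrow> cinner a y = cinner x b"
proof -
  show 1: "densely_defined S" "linear_operator S" "adjoint_operator S = S"
    using assms by (auto simp: self_adjoint_def)
  show "closed_operator S" using adjoint_closed_operator[OF 1(1)] 1(3) by simp
  show "S x = Some a \<Longrightarrow> S y = Some b \<Longrightarrow> cinner a y = cinner x b"
    using adjoint_Some[OF 1(1), of y b] 1(3) by simp
qed

lemma positive_operatorD:
  assumes "positive_operator S" "S x = Some a"
  shows "0 \<le> Re (cinner a x)"
proof -
  have "cinner (the (S x)) x \<in> \<real>\<^sub>\<ge>\<^sub>0"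
    using assms(1) domI[where m = S, OF assms(2)] unfolding positive_operator_def by blast
  then show ?thesis by (simp add: assms(2) complex_nonneg_Reals_iff)
qed

section \<open>The resolvent of the operator T* T\<close>

text \<open>\<open>R\<close> is the inverse of \<open>1 + Q\<close>, in a form that lets either operator determine the other.\<close>

definition resolvent_of :: "('a::complex_hilbert_space \<rightharpoonup> 'a) \<Rightarrow> ('a \<Rightarrow>\<^sub>L 'a) \<Rightarrow> bool" where
  "resolvent_of Q R \<longleftrightarrow> (\<forall>x z. Q x = Some z \<longleftrightarrow> R (x + z) = x)"

lemma resolvent_of_value: "resolvent_of Q R \<Longrightarrow> Q (R y) = Some (y - R y)"
  by (simp add: resolvent_of_def)

text \<open>
  The equation \<open>x + T\<^sup>* T x = y\<close> says that \<open>(x, T x)\<close> is the orthogonal projection of \<open>(y, 0)\<close> onto the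
  graph of \<open>T\<close>. Both norm bounds for \<open>R\<close> come from \<open>\<langle>R y, y\<rangle> = \<parallel>R y\<parallel>\<^sup>2 + \<parallel>T R y\<parallel>\<^sup>2\<close>.
\<close>

lemma resolvent_exists:
  assumes T: "closed_operator T" and dd: "densely_defined T"
  obtains R where "resolvent_of (adjoint_operator T \<circ>\<^sub>m T) R" "nonneg_op R"
    "norm R \<le> 1" "norm (id_blinfun - R) \<le> 1" "\<And>x. R x = 0 \<Longrightarrow> x = 0"
proof -
  let ?Q = "adjoint_operator T \<circ>\<^sub>m T"
  have lin: "linear_operator T" and cl: "closed (Map.graph T)"
    using T by (auto simp: closed_operator_def)
  have linQ: "linear_operator ?Q"
    using adjoint_closed_operator[OF dd] lin by (intro linear_operator_comp) (auto simp: closed_operator_def)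
  have Q_iff: "?Q x = Some z \<longleftrightarrow> (\<exists>a. T x = Some a \<and> (\<forall>x' a'. T x' = Some a' \<longrightarrow> cinner a' a = cinner x' z))"
    for x z by (simp add: map_comp_Some_iff adjoint_Some[OF dd])
  have "\<exists>x. ?Q x = Some (y - x)" for y
  proof -
    obtain p where p: "p \<in> Map.graph T" "\<And>m. m \<in> Map.graph T \<Longrightarrow> cinner ((y, 0) - p) m = 0"
      by (rule orthogonal_projection[OF graph_subspace(1)[OF lin] cl, of "(y, 0)"]) blast
    obtain x a where xa: "p = (x, a)" by (cases p)
    have "cinner a' a = cinner x' (y - x)" if "T x' = Some a'" for x' a'
    proof -
      have "cinner (y - x) x' - cinner a a' = 0"
        using p(2)[of "(x', a')"] that by (simp add: xa in_graph_iff)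
      then have "cinner (y - x) x' = cinner a a'" by simp
      then show ?thesis by (metis cinner_commute)
    qed
    then have "?Q x = Some (y - x)" unfolding Q_iff using p(1) by (auto simp: xa in_graph_iff)
    then show ?thesis by blast
  qed
  then obtain r where r: "\<And>y. ?Q (r y) = Some (y - r y)" by metis
  have sym: "cinner z x' = cinner x z'" if "?Q x = Some z" "?Q x' = Some z'" for x z x' z'
    using that unfolding Q_iff by (metis cinner_commute)
  have pos: "0 \<le> Re (cinner z x)" if Qx: "?Q x = Some z" for x z
  proof -
    obtain a where "T x = Some a" "\<forall>x' a'. T x' = Some a' \<longrightarrow> cinner a' a = cinner x' z"
      using Qx unfolding Q_iff by blast
    then have "cinner a a = cinner x z" by blast
    then have "Re (cinner x z) = (norm a)\<^sup>2" by (metis Re_cinner_self)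
    then show ?thesis by (simp add: Re_cinner_commute[of z])
  qed
  have uniq: "x = r (x + z)" if "?Q x = Some z" for x z
  proof -
    let ?d = "x - r (x + z)"
    have "?Q ?d = Some (z - (x + z - r (x + z)))" by (rule linear_operatorD(4)[OF linQ that r])
    then have "0 \<le> Re (cinner (- ?d) ?d)" using pos by fastforce
    then have "(norm ?d)\<^sup>2 \<le> 0" by (simp only: cinner_minus_left uminus_complex.sel Re_cinner_self)
    then show ?thesis by simp
  qed
  have basic: "(norm (r y))\<^sup>2 \<le> Re (cinner (r y) y)" for y
    using pos[OF r, of y] Re_cinner_commute[of y "r y"]
    by (simp add: cinner_simps Re_cinner_self)
  have nr: "norm (r y) \<le> norm y" for y
  proof -
    have "norm (r y) * norm (r y) \<le> norm (r y) * norm y"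
      using basic[of y] Re_cinner_le[of "r y" y] by (simp add: power2_eq_square)
    then show ?thesis by (cases "r y = 0") auto
  qed
  have "bounded_linear r"
  proof (rule bounded_linear_intro[where K = 1])
    show "r (x + y) = r x + r y" for x y
      using uniq[OF linear_operatorD(1)[OF linQ r r, of x y]] by simp
    show "r (k *\<^sub>R x) = k *\<^sub>R r x" for k x
      using uniq[OF linear_operatorD(5)[OF linQ r, of k x]] by (simp add: scaleR_diff_right)
  qed (simp add: nr)
  then have R: "blinfun_apply (Blinfun r) = r" by (rule bounded_linear_Blinfun_apply)
  show ?thesis
  proof (rule that[of "Blinfun r"])
    show "resolvent_of ?Q (Blinfun r)"
      unfolding resolvent_of_def R using uniq r by (metis add_diff_cancel_left')
    have "cinner (r x) y = cinner x (r y)" for x y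
      using sym[OF r r, of x y] by (simp add: cinner_simps)
    then show "nonneg_op (Blinfun r)"
      using basic by (auto simp: nonneg_op_def adj_def R intro: order_trans[OF zero_le_power2])
    show "norm (Blinfun r) \<le> 1"
      by (rule norm_blinfun_bound) (auto simp: R nr)
    show "norm (id_blinfun - Blinfun r) \<le> 1"
    proof (rule norm_blinfun_bound)
      fix y
      have "(norm (y - r y))\<^sup>2 \<le> (norm y)\<^sup>2"
        using basic[of y] norm_diff_sq[of y "r y"] Re_cinner_commute[of y "r y"]
          zero_le_power2[of "norm (r y)"] by linarith
      then have "norm (y - r y) \<le> norm y" by (rule power2_le_imp_le) simp
      then show "norm ((id_blinfun - Blinfun r) y) \<le> 1 * norm y" by (simp add: blinfun.diff_left R)
    qed simp
    show "x = 0" if "Blinfun r x = 0" for x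
      using r[of x] that linear_operatorD(3)[OF linQ] by (simp add: R)
  qed
qed

text \<open>
  This says \<open>R = (1 + F\<^sup>* F)\<^sup>-\<^sup>1\<close>, with \<open>F\<^sup>* (F (R y)) = y - R y\<close> written out by inner products, which for
  \<open>F = A\<^sup>*\<close> avoids identifying the adjoint of \<open>A\<^sup>*\<close> with \<open>A\<close>. For normal \<open>A\<close> one \<open>R\<close> serves \<open>A\<close>, \<open>A\<^sup>*\<close> and \<open>\<bar>A\<bar>\<close>.
\<close>

definition has_resolvent :: "('a::complex_hilbert_space \<rightharpoonup> 'a) \<Rightarrow> ('a \<Rightarrow>\<^sub>L 'a) \<Rightarrow> bool" where
  "has_resolvent F R \<longleftrightarrow> (\<forall>y. \<exists>w. F (R y) = Some w \<and>
     (\<forall>x a. F x = Some a \<longrightarrow> cinner a w = cinner x (y - R y)))"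

lemma has_resolventI:
  assumes "densely_defined T" "resolvent_of (adjoint_operator T \<circ>\<^sub>m T) R"
  shows "has_resolvent T R"
  using resolvent_of_value[OF assms(2)]
  by (simp add: has_resolvent_def map_comp_Some_iff adjoint_Some[OF assms(1)])

lemma has_resolvent_norm:
  assumes "has_resolvent F R"
  obtains w where "F (R y) = Some w" "(norm w)\<^sup>2 = Re (cinner (R y) (y - R y))"
  using assms unfolding has_resolvent_def by (metis Re_cinner_self)

text \<open>In the graph of \<open>F\<close>, orthogonality of \<open>(x, F x)\<close> to \<open>(R y, F (R y))\<close> says \<open>\<langle>x, y\<rangle> = 0\<close>.\<close>

lemma range_resolvent_core:
  assumes F: "closed_operator F" and R: "has_resolvent F R"
    and RC: "\<And>k x. blinfun_apply R (k *\<^sub>C x) = k *\<^sub>C R x"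
  shows "closure {(x, a). F x = Some a \<and> x \<in> range (blinfun_apply R)} = Map.graph F"
proof (rule dense_subspaceI)
  have lin: "linear_operator F" using F by (simp add: closed_operator_def)
  show "complex_vector.subspace (Map.graph F)" by (rule graph_subspace(1)[OF lin])
  show "closed (Map.graph F)" using F by (simp add: closed_operator_def)
  show "{(x, a). F x = Some a \<and> x \<in> range (blinfun_apply R)} \<subseteq> Map.graph F"
    by (auto simp: in_graph_iff)
  show "complex_vector.subspace {(x, a). F x = Some a \<and> x \<in> range (blinfun_apply R)}"
    using complex_subspaceD[OF range_complex_subspace[OF RC]]
    by (intro complex_vector.subspaceI) (auto simp: zero_prod_def intro: linear_operatorD[OF lin])
  fix p assume p: "p \<in> Map.graph F"
    and orth: "\<And>m. m \<in> {(x, a). F x = Some a \<and> x \<in> range (blinfun_apply R)} \<Longrightarrow> cinner p m = 0"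
  obtain x a where xa: "p = (x, a)" "F x = Some a" using p by (cases p) (auto simp: in_graph_iff)
  have "cinner x y = 0" for y
  proof -
    obtain w where w: "F (R y) = Some w" "cinner a w = cinner x (y - R y)"
      using R xa(2) unfolding has_resolvent_def by blast
    then show ?thesis using orth[of "(R y, w)"] by (simp add: xa(1) cinner_simps)
  qed
  then have "x = 0" using cinner_eq_zero_iff by blast
  then show "p = 0" using xa linear_operatorD(3)[OF lin] by (simp add: zero_prod_def)
qed

text \<open>
  If \<open>x\<close> is approached in the graph norm of \<open>T1\<close> by elements of \<open>D\<close>, their images under \<open>T1\<close> form a
  Cauchy sequence; by equality of norms so do their images under \<open>T2\<close>.
\<close>

lemma same_norm_on_core:
  assumes T1: "closed_operator T1" and T2: "closed_operator T2"
    and core: "Map.graph T1 \<subseteq> closure {(x, a). T1 x = Some a \<and> x \<in> D}"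
    and D: "\<And>x y. x \<in> D \<Longrightarrow> y \<in> D \<Longrightarrow> x - y \<in> D"
    and eq: "\<And>x a. x \<in> D \<Longrightarrow> T1 x = Some a \<Longrightarrow> \<exists>b. T2 x = Some b \<and> norm b = norm a"
    and x: "T1 x = Some a"
  shows "\<exists>b. T2 x = Some b \<and> norm b = norm a"
proof -
  have lin: "linear_operator T1" "linear_operator T2"
    using T1 T2 by (auto simp: closed_operator_def)
  have "(x, a) \<in> closure {(x, a). T1 x = Some a \<and> x \<in> D}"
    using core x by (auto simp: in_graph_iff)
  then obtain f where f: "\<And>n. f n \<in> {(x, a). T1 x = Some a \<and> x \<in> D}" "f \<longlonglongrightarrow> (x, a)"
    unfolding closure_sequential by blast
  define u where "u n = fst (f n)" for n
  define v where "v n = snd (f n)" for n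
  have uv: "T1 (u n) = Some (v n)" "u n \<in> D" for n
    using f(1)[of n] by (auto simp: u_def v_def)
  have lim: "u \<longlonglongrightarrow> x" "v \<longlonglongrightarrow> a"
    using tendsto_fst[OF f(2)] tendsto_snd[OF f(2)] by (simp_all add: u_def[abs_def] v_def[abs_def])
  obtain w where w: "\<And>n. T2 (u n) = Some (w n)" "\<And>n. norm (w n) = norm (v n)"
    using eq[OF uv(2) uv(1)] by metis
  have dist: "dist (w m) (w n) = dist (v m) (v n)" for m n
    using eq[OF D[OF uv(2) uv(2)] linear_operatorD(4)[OF lin(1) uv(1) uv(1)], of m n]
      linear_operatorD(4)[OF lin(2) w(1) w(1), of m n] by (simp add: dist_norm)
  have "Cauchy v" using lim(2) by (rule LIMSEQ_imp_Cauchy)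
  then have "Cauchy w" by (simp add: Cauchy_def dist)
  then obtain b where b: "w \<longlonglongrightarrow> b" using Cauchy_convergent_iff convergent_def by blast
  have "T2 x = Some b" by (rule closed_operator_limit[OF T2 w(1) lim(1) b])
  moreover have "norm b = norm a"
    using tendsto_norm[OF b] tendsto_norm[OF lim(2)] by (simp add: w(2) LIMSEQ_unique)
  ultimately show ?thesis by blast
qed

text \<open>
  \<open>\<parallel>T (R y)\<parallel>\<^sup>2 = \<langle>R y, y - R y\<rangle>\<close> depends on \<open>R\<close> only, and \<open>range R\<close> is a core of both operators.
\<close>

lemma same_resolvent_same_norm:
  assumes "closed_operator T1" "has_resolvent T1 R" "closed_operator T2" "has_resolvent T2 R"
    and RC: "\<And>k x. blinfun_apply R (k *\<^sub>C x) = k *\<^sub>C R x" and "T1 x = Some a"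
  shows "\<exists>b. T2 x = Some b \<and> norm b = norm a"
proof (rule same_norm_on_core[OF assms(1,3) _ _ _ assms(6)])
  show "Map.graph T1 \<subseteq> closure {(x, a). T1 x = Some a \<and> x \<in> range (blinfun_apply R)}"
    using range_resolvent_core[OF assms(1,2) RC] by simp
  show "x - y \<in> range (blinfun_apply R)"
    if "x \<in> range (blinfun_apply R)" "y \<in> range (blinfun_apply R)" for x y
    using that by (auto simp: image_iff blinfun.diff_right[symmetric])
  fix x a assume "x \<in> range (blinfun_apply R)" and a: "T1 x = Some a"
  then obtain y where y: "x = R y" by blast
  obtain w where w: "T2 (R y) = Some w" "(norm w)\<^sup>2 = Re (cinner (R y) (y - R y))"
    using assms(4) by (rule has_resolvent_norm)
  obtain w' where "T1 (R y) = Some w'" "(norm w')\<^sup>2 = Re (cinner (R y) (y - R y))"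
    using assms(2) by (rule has_resolvent_norm)
  then have "(norm w)\<^sup>2 = (norm a)\<^sup>2" using w(2) a y by simp
  then have "norm w = norm a" by simp
  then show "\<exists>b. T2 x = Some b \<and> norm b = norm a" using w(1) y by blast
qed

text \<open>With \<open>q = F (R x)\<close>, the vector \<open>F (G q) = F (x - R x)\<close> is \<open>F x - q\<close>, whence \<open>R (q + (F x - q)) = q\<close>.\<close>

lemma resolvent_commutes:
  assumes F: "linear_operator F" and FG: "resolvent_of (F \<circ>\<^sub>m G) R" and GF: "resolvent_of (G \<circ>\<^sub>m F) R"
    and x: "F x = Some a"
  shows "F (R x) = Some (R a)"
proof -
  obtain q where q: "F (R x) = Some q" "G q = Some (x - R x)"
    using resolvent_of_value[OF GF, of x] by (auto simp: map_comp_Some_iff)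
  have "F (x - R x) = Some (a - q)" by (rule linear_operatorD(4)[OF F x q(1)])
  then have "(F \<circ>\<^sub>m G) q = Some (a - q)" using q(2) by (auto simp: map_comp_Some_iff)
  then have "R (q + (a - q)) = q" using FG by (simp only: resolvent_of_def)
  then show ?thesis using q(1) by simp
qed

section \<open>Positive square roots of unbounded operators\<close>

text \<open>
  For a positive square root \<open>S\<close> of \<open>Q\<close> the operator \<open>W = S R\<close> is bounded and positive with
  \<open>W\<^sup>2 = (1 - R) R\<close>. So \<open>Q\<close> determines \<open>W\<close>, which is \<open>S\<close> on the core \<open>range R\<close>.
\<close>

lemma sqrt_resolvent:
  assumes S: "self_adjoint S" and pos: "positive_operator S" and Q: "resolvent_of (S \<circ>\<^sub>m S) R"
    and R: "adj R R" "norm R \<le> 1" "norm (id_blinfun - R) \<le> 1"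
  obtains W where "nonneg_op W" "W o\<^sub>L W = R - (R o\<^sub>L R)" "norm (id_blinfun - (W o\<^sub>L W)) \<le> 1"
    "\<And>y. S (R y) = Some (W y)"
proof -
  note sa = self_adjointD[OF S]
  obtain W where W: "\<And>y. S (R y) = Some (W y)" "\<And>y. S (W y) = Some (y - R y)"
    using resolvent_of_value[OF Q] unfolding map_comp_Some_iff by metis
  have nW: "norm (W y) \<le> norm y" for y
  proof -
    have n1: "norm (R y) \<le> norm y" for y
      using norm_blinfun[of R y] R(2) mult_right_mono[OF R(2) norm_ge_zero[of y]] by simp
    have n2: "norm (y - R y) \<le> norm y" for y
      using norm_blinfun[of "id_blinfun - R" y] mult_right_mono[OF R(3) norm_ge_zero[of y]]
      by (simp add: blinfun.diff_left)
    have "(norm (W y))\<^sup>2 = Re (cinner (R y) (y - R y))"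
      using sa(5)[OF W(1) W(2), of y y] by (metis Re_cinner_self)
    also have "\<dots> \<le> norm (R y) * norm (y - R y)" by (rule Re_cinner_le)
    also have "\<dots> \<le> norm y * norm y" by (intro mult_mono n1 n2) auto
    finally have "(norm (W y))\<^sup>2 \<le> (norm y)\<^sup>2" by (simp add: power2_eq_square)
    then show ?thesis by (rule power2_le_imp_le) simp
  qed
  have "bounded_linear W"
  proof (rule bounded_linear_intro[where K = 1])
    show "W (x + y) = W x + W y" for x y
      using linear_operatorD(1)[OF sa(3) W(1) W(1), of x y] W(1)[of "x + y"]
      by (simp add: blinfun.add_right)
    show "W (k *\<^sub>R x) = k *\<^sub>R W x" for k x
      using linear_operatorD(5)[OF sa(3) W(1), of k x] W(1)[of "k *\<^sub>R x"]
      by (simp add: blinfun.scaleR_right)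
  qed (simp add: nW)
  then have B: "blinfun_apply (Blinfun W) = W" by (rule bounded_linear_Blinfun_apply)
  have adjW: "cinner (W x) y = cinner x (W y)" for x y
    using sa(5)[OF W(1) W(1), of x y] sa(5)[OF W(2) W(2), of x y] by (simp add: cinner_simps)
  have WW: "W (W y) = R y - R (R y)" for y
    using resolvent_commutes[OF sa(3) Q Q W(2), of y] W(1)[of "W y"] by (simp add: blinfun.diff_right)
  show ?thesis
  proof (rule that[of "Blinfun W"])
    show "nonneg_op (Blinfun W)"
      unfolding nonneg_op_def
    proof (intro conjI allI)
      show "adj (Blinfun W) (Blinfun W)" by (simp add: adj_def B adjW)
      fix y
      have "0 \<le> Re (cinner (W y) (R y))" "0 \<le> Re (cinner (y - R y) (W y))"
        using positive_operatorD[OF pos W(1)] positive_operatorD[OF pos W(2)] by blast+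
      then show "0 \<le> Re (cinner (Blinfun W y) y)"
        unfolding B Re_cinner_commute[of "y - R y"] by (simp add: cinner_simps)
    qed
    show "Blinfun W o\<^sub>L Blinfun W = R - (R o\<^sub>L R)"
      by (rule blinfun_eqI) (simp add: B WW blinfun.diff_left)
    show "norm (id_blinfun - (Blinfun W o\<^sub>L Blinfun W)) \<le> 1"
    proof (rule norm_blinfun_bound)
      fix y
      have "cinner y (W (W y)) = cinner (W y) (W y)" by (simp add: adjW)
      then have "Re (cinner y (W (W y))) = (norm (W y))\<^sup>2" by (simp only: Re_cinner_self)
      moreover have "(norm (W (W y)))\<^sup>2 \<le> (norm (W y))\<^sup>2" by (intro power_mono nW) simp
      ultimately have "(norm (y - W (W y)))\<^sup>2 \<le> (norm y)\<^sup>2"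
        using norm_diff_sq[of y "W (W y)"] zero_le_power2[of "norm (W y)"] by linarith
      then have "norm (y - W (W y)) \<le> norm y" by (rule power2_le_imp_le) simp
      then show "norm ((id_blinfun - (Blinfun W o\<^sub>L Blinfun W)) y) \<le> 1 * norm y"
        by (simp add: blinfun.diff_left B)
    qed simp
  qed (simp add: B W(1))
qed

lemma positive_sqrt_unique:
  assumes S: "self_adjoint S" "positive_operator S" and S': "self_adjoint S'" "positive_operator S'"
    and eq: "S \<circ>\<^sub>m S = S' \<circ>\<^sub>m S'"
  shows "S = S'"
proof -
  note sa = self_adjointD[OF S(1)] and sa' = self_adjointD[OF S'(1)]
  obtain R where R: "resolvent_of (S \<circ>\<^sub>m S) R" "nonneg_op R" "norm R \<le> 1" "norm (id_blinfun - R) \<le> 1"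
    using resolvent_exists[OF sa(1,2)] unfolding sa(4) by metis
  note aR = nonneg_opD(1)[OF R(2)]
  note RC = adj_scaleC[OF aR]
  obtain W where W: "nonneg_op W" "W o\<^sub>L W = R - (R o\<^sub>L R)" "norm (id_blinfun - (W o\<^sub>L W)) \<le> 1"
    "\<And>y. S (R y) = Some (W y)"
    by (rule sqrt_resolvent[OF S R(1) aR R(3,4)]) blast
  obtain W' where W': "nonneg_op W'" "W' o\<^sub>L W' = R - (R o\<^sub>L R)" "norm (id_blinfun - (W' o\<^sub>L W')) \<le> 1"
    "\<And>y. S' (R y) = Some (W' y)"
    by (rule sqrt_resolvent[OF S' R(1)[unfolded eq] aR R(3,4)]) blast
  have WW': "W = W'" by (rule nonneg_sqrt_unique[OF W(1) W'(1) _ W(3)]) (simp add: W(2) W'(2))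
  have "{(x, a). S x = Some a \<and> x \<in> range (blinfun_apply R)} =
        {(x, a). S' x = Some a \<and> x \<in> range (blinfun_apply R)}"
    using W(4) W'(4) WW' by auto
  moreover have "has_resolvent S R" by (rule has_resolventI[OF sa(2)]) (simp add: sa(4) R(1))
  moreover have "has_resolvent S' R" by (rule has_resolventI[OF sa'(2)]) (simp add: sa'(4) R(1) eq[symmetric])
  ultimately have "Map.graph S = Map.graph S'"
    using range_resolvent_core[OF sa(1) _ RC] range_resolvent_core[OF sa'(1) _ RC] by metis
  then show ?thesis by (intro map_eqI) (metis in_graph_iff)
qed

lemma operator_abs_eqI:
  assumes "self_adjoint S" "positive_operator S" "S \<circ>\<^sub>m S = adjoint_operator T \<circ>\<^sub>m T"
  shows "operator_abs T = S"
  unfolding operator_abs_def using assms by (intro the_equality) (auto intro: positive_sqrt_unique)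

text \<open>
  This is \<open>s c\<^sup>-\<^sup>1\<close>. Every positive self-adjoint operator \<open>S\<close> has this form, with \<open>c = (1 + S\<^sup>2)\<^bsup>-1/2\<^esup>\<close> and
  \<open>s = S c\<close>; then \<open>u \<mapsto> (c u, s u)\<close> is an isometry of \<open>H\<close> onto the graph.
\<close>

definition quotient_operator :: "('a::complex_hilbert_space \<Rightarrow>\<^sub>L 'a) \<Rightarrow> ('a \<Rightarrow>\<^sub>L 'a) \<Rightarrow> ('a \<rightharpoonup> 'a)" where
  "quotient_operator c s = map_of_graph (range (\<lambda>u. (c u, s u)))"

text \<open>
  \<open>c\<close> and \<open>s\<close> behave like the cosine and sine of an operator angle in \<open>[0, \<pi>/2)\<close>, whose tangent is
  \<open>s c\<^sup>-\<^sup>1\<close>. The bounds on the distance to the identity say that \<open>c, s \<le> 2\<close>, the range in which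
  nonnegative operators have been given square roots.
\<close>

locale cos_sin =
  fixes c s :: "'a::complex_hilbert_space \<Rightarrow>\<^sub>L 'a"
  assumes c: "nonneg_op c" and s: "nonneg_op s" and c_near_id: "norm (id_blinfun - c) \<le> 1"
    and s_near_id: "norm (id_blinfun - s) \<le> 1"
    and cc_ss: "c (c x) + s (s x) = x" and cs: "c (s x) = s (c x)"
    and c_inj: "c x = 0 \<Longrightarrow> x = 0"
begin

lemmas adj_c = nonneg_opD(1)[OF c] and adj_s = nonneg_opD(1)[OF s]

lemma ss: "s (s x) = x - c (c x)"
  using cc_ss[of x] by (simp add: algebra_simps)

lemma c_eqD: "c x = c y \<Longrightarrow> x = y"
  using c_inj[of "x - y"] by (simp add: blinfun.diff_right)

lemma quotient_Some: "quotient_operator c s x = Some y \<longleftrightarrow> (\<exists>u. x = c u \<and> y = s u)"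
  unfolding quotient_operator_def
  by (subst map_of_graph_Some) (auto simp: single_valued_def dest!: c_eqD)

lemma quotient_at_range: "quotient_operator c s (c u) = Some (s u)"
  by (auto simp: quotient_Some)

lemma nonneg_sc: "nonneg_op (c o\<^sub>L s)"
  by (rule nonneg_compose[OF c s c_near_id cs])

lemma range_c_dense: "closure (range (blinfun_apply c)) = UNIV"
  by (rule self_adjoint_dense_range[OF adj_c c_inj])

lemma quotient_linear: "linear_operator (quotient_operator c s)"
proof (rule linear_operatorI)
  show "quotient_operator c s 0 = Some 0"
    using quotient_at_range[of 0] by (simp add: blinfun.zero_right)
  fix x y a b k assume "quotient_operator c s x = Some a"
  then obtain u where u: "x = c u" "a = s u" by (auto simp: quotient_Some)
  show "quotient_operator c s (k *\<^sub>C x) = Some (k *\<^sub>C a)"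
    unfolding u adj_scaleC[OF adj_c, symmetric] adj_scaleC[OF adj_s, symmetric] by (rule quotient_at_range)
  assume "quotient_operator c s y = Some b"
  then obtain v where v: "y = c v" "b = s v" by (auto simp: quotient_Some)
  show "quotient_operator c s (x + y) = Some (a + b)"
    unfolding u v blinfun.add_right[symmetric] by (rule quotient_at_range)
qed

lemma quotient_densely_defined: "densely_defined (quotient_operator c s)"
proof -
  have "dom (quotient_operator c s) = range (blinfun_apply c)"
    by (auto simp: dom_def quotient_Some)
  then show ?thesis by (simp add: densely_defined_def range_c_dense)
qed

text \<open>
  If \<open>s y = c z\<close>, then \<open>u = c y + s z\<close> has \<open>c u = (c\<^sup>2 + s\<^sup>2) y = y\<close> and \<open>s u = z\<close>. Self-adjointness follows, since
  \<open>s y = c z\<close> is also the condition for \<open>(y, z)\<close> to lie in the graph of the adjoint.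
\<close>

lemma quotient_Some_iff: "quotient_operator c s y = Some z \<longleftrightarrow> s y = c z"
proof
  assume "s y = c z"
  then have "y = c (c y + s z)" "z = s (c y + s z)"
    using cc_ss[of y] cc_ss[of z] by (auto simp: blinfun.add_right cs[symmetric] add.commute)
  then show "quotient_operator c s y = Some z" unfolding quotient_Some by blast
qed (auto simp: quotient_Some cs)

lemma quotient_self_adjoint: "self_adjoint (quotient_operator c s)"
  unfolding self_adjoint_def
proof (intro conjI quotient_linear quotient_densely_defined map_eqI)
  fix y z
  have "adjoint_operator (quotient_operator c s) y = Some z \<longleftrightarrow> (\<forall>u. cinner (s u) y = cinner (c u) z)"
    unfolding adjoint_Some[OF quotient_densely_defined] by (auto simp: quotient_Some)
  also have "\<dots> \<longleftrightarrow> s y = c z"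
    by (auto simp: adjD[OF adj_s] adjD[OF adj_c] intro: cinner_eqI_right)
  finally show "adjoint_operator (quotient_operator c s) y = Some z \<longleftrightarrow> quotient_operator c s y = Some z"
    by (simp add: quotient_Some_iff)
qed

lemma quotient_positive: "positive_operator (quotient_operator c s)"
  unfolding positive_operator_def
proof (intro conjI quotient_linear ballI)
  fix x assume "x \<in> dom (quotient_operator c s)"
  then obtain u where u: "x = c u" "quotient_operator c s x = Some (s u)"
    by (auto simp: dom_def quotient_Some)
  have "cinner (s u) (c u) = cinner u (s (c u))" by (rule adjD[OF adj_s])
  also have "\<dots> = cinner (c (s u)) u" by (simp add: adjD[OF adj_c] adjD[OF adj_s])
  finally have "cinner (s u) (c u) = cinner ((c o\<^sub>L s) u) u" by simp
  then show "cinner (the (quotient_operator c s x)) x \<in> \<real>\<^sub>\<ge>\<^sub>0"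
    using nonneg_op_cinner[OF nonneg_sc, of u] u by simp
qed

lemma quotient_square:
  "resolvent_of (quotient_operator c s \<circ>\<^sub>m quotient_operator c s) (c o\<^sub>L c)"
  unfolding resolvent_of_def
proof (intro allI iffI)
  fix x z assume "(quotient_operator c s \<circ>\<^sub>m quotient_operator c s) x = Some z"
  then obtain u v where uv: "x = c u" "s u = c v" "z = s v" by (auto simp: map_comp_Some_iff quotient_Some)
  have "c (c (c u + s v)) = c (c (c u) + s (c v))" by (simp add: blinfun.add_right cs)
  then show "(c o\<^sub>L c) (x + z) = x" using uv(2) cc_ss[of u] by (simp add: uv)
next
  fix x z assume *: "(c o\<^sub>L c) (x + z) = x"
  have "s (s (x + z)) = z" using * by (simp add: ss)
  moreover have "quotient_operator c s x = Some (s (c (x + z)))"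
    using * quotient_at_range[of "c (x + z)"] by simp
  moreover have "s (c (x + z)) = c (s (x + z))" by (simp add: cs)
  ultimately show "(quotient_operator c s \<circ>\<^sub>m quotient_operator c s) x = Some z"
    using quotient_at_range[of "s (x + z)"] by (simp add: map_comp_Some_iff)
qed

end

text \<open>
  \<open>c\<close> and \<open>s\<close> are the square roots of \<open>R = (1 + T\<^sup>* T)\<^sup>-\<^sup>1\<close> and \<open>1 - R\<close>. The square of \<open>s c\<^sup>-\<^sup>1\<close> has resolvent
  \<open>c\<^sup>2 = R\<close> as well, so it equals \<open>T\<^sup>* T\<close>.
\<close>

theorem operator_abs_representation:
  assumes T: "closed_operator T" "densely_defined T"
  obtains c s where "cos_sin c s" "subordinate c (c o\<^sub>L c)" "subordinate s (c o\<^sub>L c)"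
    "resolvent_of (adjoint_operator T \<circ>\<^sub>m T) (c o\<^sub>L c)" "operator_abs T = quotient_operator c s"
proof -
  obtain R where R: "resolvent_of (adjoint_operator T \<circ>\<^sub>m T) R" "nonneg_op R" "norm R \<le> 1"
    "norm (id_blinfun - R) \<le> 1" "\<And>x. R x = 0 \<Longrightarrow> x = 0"
    by (rule resolvent_exists[OF T]) blast
  note aR = nonneg_opD(1)[OF R(2)]
  obtain c where c_sqrt: "nonneg_op c" "c o\<^sub>L c = R" "norm (id_blinfun - c) \<le> 1" "subordinate c R"
    by (rule sqrt_exists[OF aR R(4)]) blast
  have "norm (id_blinfun - (id_blinfun - R)) \<le> 1" using R(3) by simp
  then obtain s where s_sqrt: "nonneg_op s" "s o\<^sub>L s = id_blinfun - R" "subordinate s (id_blinfun - R)"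
    "norm (id_blinfun - s) \<le> 1"
    using sqrt_exists[OF adj_diff[OF adj_id aR]] by metis
  have cR: "c (c x) = R x" for x using c_sqrt(2) by (metis blinfun_apply_blinfun_compose)
  have sR: "s (s x) = x - R x" for x
    using arg_cong[OF s_sqrt(2), of "\<lambda>Z. blinfun_apply Z x"] by (simp add: blinfun.diff_left)
  have sub_s: "subordinate s R"
    unfolding subordinate_def
  proof (intro allI impI)
    fix K x y assume K: "subspace K" "closed K" "\<forall>x y. (x, y) \<in> K \<longrightarrow> (R x, R y) \<in> K" "(x, y) \<in> K"
    show "(s x, s y) \<in> K"
    proof (rule subordinateD[OF s_sqrt(3) K(1,2) _ K(4)])
      show "((id_blinfun - R) x, (id_blinfun - R) y) \<in> K" if "(x, y) \<in> K" for x y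
        using subspace_diff[OF K(1) that] K(3) that by (fastforce simp: blinfun.diff_left)
    qed
  qed
  have cs: "c (s x) = s (c x)" for x
  proof (rule subordinate_commutes[OF sub_s])
    show "c (R x) = R (c x)" for x by (simp add: cR[symmetric])
  qed
  interpret cos_sin c s
  proof
    show "x = 0" if "c x = 0" for x
      using R(5)[of x] cR[of x] that by (simp add: blinfun.zero_right)
  qed (simp_all add: c_sqrt s_sqrt cR sR cs)
  have "operator_abs T = quotient_operator c s"
  proof (rule operator_abs_eqI[OF quotient_self_adjoint quotient_positive])
    have "resolvent_of (quotient_operator c s \<circ>\<^sub>m quotient_operator c s) R"
      using quotient_square c_sqrt(2) by simp
    then show "quotient_operator c s \<circ>\<^sub>m quotient_operator c s = adjoint_operator T \<circ>\<^sub>m T"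
      using R(1) by (intro map_eqI) (simp add: resolvent_of_def)
  qed
  then show ?thesis using that cos_sin_axioms c_sqrt(2,4) sub_s R(1) by blast
qed

section \<open>Operators commuting with a normal operator\<close>

context cos_sin
begin

lemma norm_sq_cs: "(norm (c u))\<^sup>2 + (norm (s u))\<^sup>2 = (norm u)\<^sup>2"
proof -
  have "(norm (c u))\<^sup>2 + (norm (s u))\<^sup>2 = Re (cinner u (c (c u) + s (s u)))"
    by (simp add: norm_sq_adj[OF adj_c] norm_sq_adj[OF adj_s] cinner_simps)
  then show ?thesis by (simp add: cc_ss Re_cinner_self)
qed

lemma cc_scaleC: "(c o\<^sub>L c) (k *\<^sub>C x) = k *\<^sub>C (c o\<^sub>L c) x"
  by (simp add: adj_scaleC[OF adj_c])

lemma quotient_has_resolvent: "has_resolvent (quotient_operator c s) (c o\<^sub>L c)"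
  using quotient_square
  by (intro has_resolventI quotient_densely_defined) (simp add: self_adjointD(4)[OF quotient_self_adjoint])

lemma quotient_closed: "closed_operator (quotient_operator c s)"
  by (rule self_adjointD(1)[OF quotient_self_adjoint])

text \<open>
  The operator \<open>M = c\<^sup>-\<^sup>1 X c\<close> is bounded by \<open>\<parallel>X\<parallel>\<close>, because \<open>\<parallel>c\<^sup>-\<^sup>1 x\<parallel>\<^sup>2 = \<parallel>x\<parallel>\<^sup>2 + \<parallel>F x\<parallel>\<^sup>2\<close> is the squared graph
  norm of \<open>F\<close>, and \<open>X\<close> increases the graph norm at most by the factor \<open>\<parallel>X\<parallel>\<close>. That \<open>M\<close> again commutes with
  \<open>F\<close> rests on \<open>y = c\<^sup>2 y + G (F (c\<^sup>2 y))\<close> for \<open>y = M x\<close>: with \<open>z = M (F x)\<close> the last term is \<open>G (c\<^sup>2 z)\<close>, which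
  lies in the domain of \<open>F\<close> because \<open>F G\<close> has the resolvent \<open>c\<^sup>2\<close> too.
\<close>

lemma conjugate_exists:
  assumes F: "closed_operator F" and FR: "has_resolvent F (c o\<^sub>L c)"
    and FG: "resolvent_of (F \<circ>\<^sub>m G) (c o\<^sub>L c)" and GF: "resolvent_of (G \<circ>\<^sub>m F) (c o\<^sub>L c)"
    and sub: "subordinate c (c o\<^sub>L c)"
    and X: "\<And>x a. F x = Some a \<Longrightarrow> F (blinfun_apply X x) = Some (X a)"
  obtains M where "norm M \<le> norm X" "\<And>x. c (blinfun_apply M x) = X (c x)"
    "\<And>x a. F x = Some a \<Longrightarrow> F (M x) = Some (M a)"
proof -
  have lin: "linear_operator F" using F by (simp add: closed_operator_def)
  have Fcc: "F ((c o\<^sub>L c) x) = Some ((c o\<^sub>L c) a)" if "F x = Some a" for x a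
    by (rule resolvent_commutes[OF lin FG GF that])
  have Fc: "F (c x) = Some (c a)" if "F x = Some a" for x a
  proof -
    have "(c x, c a) \<in> Map.graph F"
    proof (rule subordinateD[OF sub])
      show "subspace (Map.graph F)" by (rule graph_subspace(2)[OF lin])
      show "closed (Map.graph F)" using F by (simp add: closed_operator_def)
      show "((c o\<^sub>L c) x, (c o\<^sub>L c) y) \<in> Map.graph F" if "(x, y) \<in> Map.graph F" for x y
        using Fcc that unfolding in_graph_iff by blast
      show "(x, a) \<in> Map.graph F" using that by (simp add: in_graph_iff)
    qed
    then show ?thesis by (simp add: in_graph_iff)
  qed
  note FS = same_resolvent_same_norm[OF F FR quotient_closed quotient_has_resolvent cc_scaleC]
  note SF = same_resolvent_same_norm[OF quotient_closed quotient_has_resolvent F FR cc_scaleC]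
  have "\<exists>v. X (c u) = c v \<and> norm v \<le> norm X * norm u" for u
  proof -
    obtain a where a: "F (c u) = Some a" "norm a = norm (s u)"
      using SF[OF quotient_at_range] by blast
    obtain v where v: "X (c u) = c v" "norm (s v) = norm (X a)"
      using FS[OF X[OF a(1)]] by (auto simp: quotient_Some)
    have "(norm v)\<^sup>2 = (norm (X (c u)))\<^sup>2 + (norm (X a))\<^sup>2"
      by (simp add: norm_sq_cs[of v, symmetric] v)
    also have "\<dots> \<le> (norm X * norm (c u))\<^sup>2 + (norm X * norm a)\<^sup>2"
      by (intro add_mono power_mono norm_blinfun) auto
    also have "\<dots> = (norm X)\<^sup>2 * ((norm (c u))\<^sup>2 + (norm (s u))\<^sup>2)"
      by (simp add: a(2) power_mult_distrib distrib_left)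
    also have "\<dots> = (norm X * norm u)\<^sup>2" by (simp add: norm_sq_cs power_mult_distrib)
    finally have "norm v \<le> norm X * norm u" by (rule power2_le_imp_le) simp
    then show ?thesis using v(1) by blast
  qed
  then obtain m where m: "\<And>u. c (m u) = X (c u)" "\<And>u. norm (m u) \<le> norm X * norm u" by metis
  have "bounded_linear m"
  proof (rule bounded_linear_intro[where K = "norm X"])
    show "m (x + y) = m x + m y" for x y by (rule c_eqD) (simp add: m(1) blinfun.add_right)
    show "m (r *\<^sub>R x) = r *\<^sub>R m x" for r x by (rule c_eqD) (simp add: m(1) blinfun.scaleR_right)
    show "norm (m x) \<le> norm x * norm X" for x using m(2)[of x] by (simp add: mult.commute)
  qed
  then have M: "blinfun_apply (Blinfun m) = m" by (rule bounded_linear_Blinfun_apply)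
  show ?thesis
  proof (rule that[of "Blinfun m"])
    show "norm (Blinfun m) \<le> norm X" by (rule norm_blinfun_bound) (auto simp: M m(2))
    show "c (Blinfun m x) = X (c x)" for x by (simp add: M m(1))
    fix x a assume x: "F x = Some a"
    let ?y = "m x" and ?z = "m a"
    have "F (c ?y) = Some (c ?z)" using X[OF Fc[OF x]] by (simp add: m(1))
    then have 1: "F (c (c ?y)) = Some (c (c ?z))" by (rule Fc)
    then have "G (c (c ?z)) = Some (?y - c (c ?y))"
      using resolvent_of_value[OF GF, of ?y] by (simp add: map_comp_Some_iff)
    then have "F (?y - c (c ?y)) = Some (?z - c (c ?z))"
      using resolvent_of_value[OF FG, of ?z] by (simp add: map_comp_Some_iff)
    from linear_operatorD(1)[OF lin this 1] show "F (Blinfun m x) = Some (Blinfun m a)"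
      by (simp add: M)
  qed
qed

text \<open>The power of \<open>c\<close> with exponent \<open>2\<^sup>n\<close>.\<close>

fun c_power :: "nat \<Rightarrow> 'a \<Rightarrow>\<^sub>L 'a" where
  "c_power 0 = c"
| "c_power (Suc n) = c_power n o\<^sub>L c_power n"

lemma adj_c_power: "adj (c_power n) (c_power n)"
  by (induction n) (auto intro: adj_c adj_compose)

lemma c_power_inj: "c_power n x = 0 \<Longrightarrow> x = 0"
  by (induction n arbitrary: x) (auto dest: c_inj)

text \<open>
  Conjugates of \<open>X\<close> commute with \<open>F\<close>, so they can be conjugated in turn; doubling the exponent takes two
  applications of the induction hypothesis.
\<close>

lemma conjugate_by_power_exists:
  assumes "closed_operator F" "has_resolvent F (c o\<^sub>L c)"
    "resolvent_of (F \<circ>\<^sub>m G) (c o\<^sub>L c)" "resolvent_of (G \<circ>\<^sub>m F) (c o\<^sub>L c)" "subordinate c (c o\<^sub>L c)"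
    and "\<And>x a. F x = Some a \<Longrightarrow> F (blinfun_apply X x) = Some (X a)"
  shows "\<exists>M. norm M \<le> norm X \<and> (\<forall>x. c_power n (blinfun_apply M x) = X (c_power n x)) \<and>
    (\<forall>x a. F x = Some a \<longrightarrow> F (M x) = Some (M a))"
  using assms(6)
proof (induction n arbitrary: X)
  case 0
  then show ?case using conjugate_exists[OF assms(1-5), of X] by (metis c_power.simps(1))
next
  case (Suc n)
  obtain M where M: "norm M \<le> norm X" "\<forall>x. c_power n (blinfun_apply M x) = X (c_power n x)"
    "\<forall>x a. F x = Some a \<longrightarrow> F (M x) = Some (M a)"
    using Suc.IH[OF Suc.prems] by blast
  obtain M' where M': "norm M' \<le> norm M" "\<forall>x. c_power n (blinfun_apply M' x) = M (c_power n x)"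
    "\<forall>x a. F x = Some a \<longrightarrow> F (M' x) = Some (M' a)"
    using Suc.IH[of M] M(3) by blast
  show ?case
    using M M' order_trans[OF M'(1) M(1)] by (intro exI[of _ M']) simp
qed

end

text \<open>
  \<open>X\<close> commutes with \<open>A\<close> and \<open>X\<^sup>*\<close> commutes with \<open>A\<^sup>*\<close>. As \<open>A\<close> and \<open>A\<^sup>*\<close> have the same resolvent \<open>c\<^sup>2\<close>, both \<open>X\<close> and
  \<open>X\<^sup>*\<close> have bounded conjugates by all powers of \<open>c\<close>, hence so have the skew-adjoint operators
  \<open>X - X\<^sup>*\<close> and \<open>\<i> (X + X\<^sup>*)\<close>.
\<close>

theorem commutes_with_resolvent_of_normal:
  assumes A: "normal_operator A" and cs: "cos_sin c s" and sub: "subordinate c (c o\<^sub>L c)"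
    and res: "resolvent_of (adjoint_operator A \<circ>\<^sub>m A) (c o\<^sub>L c)"
    and X: "adj X X'" and XA: "\<And>x a. A x = Some a \<Longrightarrow> A (X x) = Some (X a)"
  shows "X (c (c x)) = c (c (X x))"
proof -
  interpret cos_sin c s by (rule cs)
  let ?G = "adjoint_operator A"
  have clA: "closed_operator A" and dd: "densely_defined A" and AG: "A \<circ>\<^sub>m ?G = ?G \<circ>\<^sub>m A"
    using A by (auto simp: normal_operator_def)
  have res': "resolvent_of (A \<circ>\<^sub>m ?G) (c o\<^sub>L c)" using res AG by simp
  have hA: "has_resolvent A (c o\<^sub>L c)" by (rule has_resolventI[OF dd res])
  have hG: "has_resolvent ?G (c o\<^sub>L c)"
    unfolding has_resolvent_def
  proof
    fix y
    obtain w where w: "?G ((c o\<^sub>L c) y) = Some w" "A w = Some (y - (c o\<^sub>L c) y)"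
      using resolvent_of_value[OF res', of y] unfolding map_comp_Some_iff by blast
    have "cinner a w = cinner x (y - (c o\<^sub>L c) y)" if "?G x = Some a" for x a
      using that w(2) unfolding adjoint_Some[OF dd] by (metis cinner_commute)
    then show "\<exists>w. ?G ((c o\<^sub>L c) y) = Some w \<and>
      (\<forall>x a. ?G x = Some a \<longrightarrow> cinner a w = cinner x (y - (c o\<^sub>L c) y))"
      using w(1) by blast
  qed
  have XG: "?G (X' y) = Some (X' z)" if "?G y = Some z" for y z
    using that unfolding adjoint_Some[OF dd] by (metis XA adjD[OF X])
  define K where "K = norm X + norm X'"
  have conj: "\<exists>M N. norm M \<le> norm X \<and> norm N \<le> norm X' \<and>
    (\<forall>x. c_power n (blinfun_apply M x) = X (c_power n x)) \<and>
    (\<forall>x. c_power n (blinfun_apply N x) = X' (c_power n x))" for n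
    using conjugate_by_power_exists[OF clA hA res' res sub XA, of n]
      conjugate_by_power_exists[OF adjoint_closed_operator[OF dd] hG res res' sub XG, of n] by blast
  note skew = commutes_if_conjugates_bounded[where C = c_power and K = K, OF _ adj_c_power c_power_inj]
  define J where "J = Blinfun (\<lambda>x::'a. \<i> *\<^sub>C x)"
  have "bounded_linear (\<lambda>x::'a. \<i> *\<^sub>C x)"
    by (rule bounded_linear_intro[where K = 1])
      (auto simp: scaleC_add_right scaleR_scaleC scaleC_scaleC mult.commute norm_scaleC)
  then have J: "J x = \<i> *\<^sub>C x" for x by (simp add: J_def bounded_linear_Blinfun_apply)
  have diff: "(X - X') (c (c x)) = c (c ((X - X') x))" for x
  proof (rule skew[where X = "X - X'", unfolded c_power.simps])
    show "adj (X - X') (- (X - X'))" using adj_diff[OF X adj_sym[OF X]] by simp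
    fix n
    obtain M N where MN: "norm M \<le> norm X" "norm N \<le> norm X'"
      "\<forall>x. c_power n (blinfun_apply M x) = X (c_power n x)"
      "\<forall>x. c_power n (blinfun_apply N x) = X' (c_power n x)"
      using conj by blast
    have "norm (M - N) \<le> K"
      using norm_triangle_ineq4[of M N] MN(1,2) by (simp add: K_def)
    then show "\<exists>M. norm M \<le> K \<and> (\<forall>x. c_power n (blinfun_apply M x) = (X - X') (c_power n x))"
      using MN(3,4) by (intro exI[of _ "M - N"]) (simp add: blinfun.bilinear_simps)
  qed auto
  have add: "(X + X') (c (c x)) = c (c ((X + X') x))" for x
  proof -
    have "(J o\<^sub>L (X + X')) (c (c x)) = c (c ((J o\<^sub>L (X + X')) x))"
    proof (rule skew[where X = "J o\<^sub>L (X + X')", unfolded c_power.simps])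
      show "adj (J o\<^sub>L (X + X')) (- (J o\<^sub>L (X + X')))"
        unfolding adj_def using adjD[OF X] adjD[OF adj_sym[OF X]]
        by (simp add: J blinfun.bilinear_simps cinner_simps algebra_simps)
      fix n
      obtain M N where MN: "norm M \<le> norm X" "norm N \<le> norm X'"
        "\<forall>x. c_power n (blinfun_apply M x) = X (c_power n x)"
        "\<forall>x. c_power n (blinfun_apply N x) = X' (c_power n x)"
        using conj by blast
      have "norm (J o\<^sub>L (M + N)) \<le> K"
      proof (rule norm_blinfun_bound)
        have "norm (M + N) \<le> K" using norm_triangle_ineq[of M N] MN(1,2) by (simp add: K_def)
        then show "norm ((J o\<^sub>L (M + N)) x) \<le> K * norm x" for x
          using order_trans[OF norm_blinfun mult_right_mono, of "M + N" K x] by (simp add: J norm_scaleC)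
      qed (simp add: K_def)
      then show "\<exists>M. norm M \<le> K \<and>
        (\<forall>x. c_power n (blinfun_apply M x) = (J o\<^sub>L (X + X')) (c_power n x))"
        using MN(3,4)
        by (intro exI[of _ "J o\<^sub>L (M + N)"])
          (simp add: J blinfun.bilinear_simps adj_scaleC[OF adj_c_power] scaleC_add_right)
    qed auto
    then show ?thesis by (simp add: J adj_scaleC[OF adj_c] complex_vector.scale_cancel_left)
  qed
  have "2 *\<^sub>R X (c (c x)) = (X - X') (c (c x)) + (X + X') (c (c x))"
    by (simp add: blinfun.bilinear_simps scaleR_2)
  also have "\<dots> = 2 *\<^sub>R c (c (X x))"
    unfolding diff add by (simp add: blinfun.bilinear_simps scaleR_2)
  finally show ?thesis by simp
qed

section \<open>Products of a positive self-adjoint operator with commuting bounded operators\<close>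

(* graphs of products are described by their elements rather than as relational compositions *)
declare graph_map_comp [simp del]

lemma comp_blinfun_right: "(S \<circ>\<^sub>m (\<lambda>x. Some (blinfun_apply X x))) x = S (X x)"
  by (simp add: map_comp_def)

lemma comp_blinfun_left:
  "((\<lambda>x. Some (blinfun_apply X x)) \<circ>\<^sub>m S) x = Some y \<longleftrightarrow> (\<exists>a. S x = Some a \<and> y = X a)"
  by (auto simp: map_comp_Some_iff)

lemma closed_operator_comp_blinfun:
  assumes S: "closed_operator S" and X: "\<And>a x. blinfun_apply X (a *\<^sub>C x) = a *\<^sub>C X x"
  shows "closed_operator (S \<circ>\<^sub>m (\<lambda>x. Some (X x)))"
  unfolding closed_operator_def
proof
  show "linear_operator (S \<circ>\<^sub>m (\<lambda>x. Some (X x)))"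
    using S by (intro linear_operator_comp linear_operator_blinfun X) (simp add: closed_operator_def)
  have "Map.graph (S \<circ>\<^sub>m (\<lambda>x. Some (X x))) = (\<lambda>p. (X (fst p), snd p)) -` Map.graph S"
    by (auto simp: in_graph_iff comp_blinfun_right)
  moreover have "closed \<dots>"
    using S by (intro closed_vimage continuous_intros) (simp add: closed_operator_def)
  ultimately show "closed (Map.graph (S \<circ>\<^sub>m (\<lambda>x. Some (X x))))" by simp
qed

lemma adjoint_blinfun:
  assumes "adj X X'"
  shows "adjoint_operator (\<lambda>x. Some (X x)) = (\<lambda>x. Some (X' x))"
proof (rule map_eqI)
  have "densely_defined (\<lambda>x. Some (X x))" by (simp add: densely_defined_def dom_def)
  then show "adjoint_operator (\<lambda>x. Some (X x)) y = Some z \<longleftrightarrow> Some (X' y) = Some z" for y z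
    by (auto simp: adjoint_Some adjD[OF assms] intro: cinner_eqI_right)
qed

lemma bounded_operatorE:
  assumes B: "bounded_operator B"
  obtains X where "B = (\<lambda>x. Some (blinfun_apply X x))" "\<And>a x. X (a *\<^sub>C x) = a *\<^sub>C X x"
proof -
  obtain K where lin: "linear_operator B" and dom: "dom B = UNIV"
    and K: "\<And>x. norm (the (B x)) \<le> K * norm x"
    using B unfolding bounded_operator_def by blast
  define f where "f x = the (B x)" for x
  have f: "B x = Some (f x)" for x
    using dom by (metis UNIV_I domD f_def option.sel)
  note L = linear_operatorD[OF lin]
  have "bounded_linear f"
  proof (rule bounded_linear_intro[where K = K])
    show "f (x + y) = f x + f y" for x y using L(1)[OF f f, of x y] f[of "x + y"] by simp
    show "f (r *\<^sub>R x) = r *\<^sub>R f x" for r x using L(5)[OF f, of r x] f[of "r *\<^sub>R x"] by simp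
    show "norm (f x) \<le> norm x * K" for x using K[of x] by (simp add: f_def mult.commute)
  qed
  then have F: "blinfun_apply (Blinfun f) = f" by (rule bounded_linear_Blinfun_apply)
  show ?thesis
  proof (rule that[of "Blinfun f"])
    show "B = (\<lambda>x. Some (Blinfun f x))" by (rule ext) (simp add: F f)
    show "Blinfun f (a *\<^sub>C x) = a *\<^sub>C Blinfun f x" for a x
      using L(2)[OF f, of a x] f[of "a *\<^sub>C x"] by (simp add: F)
  qed
qed

context cos_sin
begin

lemma graph_comp_quotient:
  "Map.graph ((\<lambda>x. Some (blinfun_apply X x)) \<circ>\<^sub>m quotient_operator c s) = range (\<lambda>u. (c u, X (s u)))"
proof
  show "Map.graph ((\<lambda>x. Some (blinfun_apply X x)) \<circ>\<^sub>m quotient_operator c s) \<subseteq> range (\<lambda>u. (c u, X (s u)))"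
    by (rule subrelI) (auto simp: in_graph_iff comp_blinfun_left quotient_Some)
  show "range (\<lambda>u. (c u, X (s u))) \<subseteq> Map.graph ((\<lambda>x. Some (blinfun_apply X x)) \<circ>\<^sub>m quotient_operator c s)"
    by (rule image_subsetI) (simp add: in_graph_iff comp_blinfun_left quotient_at_range)
qed

text \<open>
  Let \<open>S = s c\<^sup>-\<^sup>1\<close>. A pair \<open>(x, S X x)\<close> with \<open>X x = c u\<close> is orthogonal to the pair \<open>(c\<^sup>2 x, X S c\<^sup>2 x)\<close> only if
  \<open>0 = \<parallel>c x\<parallel>\<^sup>2 + \<langle>s u, s c (X x)\<rangle> = \<parallel>c x\<parallel>\<^sup>2 + \<parallel>c s u\<parallel>\<^sup>2\<close>, which forces \<open>x = 0\<close> and \<open>S X x = s u = 0\<close>.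
\<close>

lemma commuting_product_closure:
  assumes XC: "\<And>a x. blinfun_apply X (a *\<^sub>C x) = a *\<^sub>C X x"
    and Xc: "\<And>x. X (c x) = c (X x)" and Xs: "\<And>x. X (s x) = s (X x)"
  shows "closure (Map.graph ((\<lambda>x. Some (X x)) \<circ>\<^sub>m quotient_operator c s)) =
    Map.graph (quotient_operator c s \<circ>\<^sub>m (\<lambda>x. Some (X x)))"
proof (rule dense_subspaceI)
  let ?S = "quotient_operator c s"
  have cl: "closed_operator (?S \<circ>\<^sub>m (\<lambda>x. Some (X x)))"
    by (rule closed_operator_comp_blinfun[OF quotient_closed XC])
  then show "closed (Map.graph (?S \<circ>\<^sub>m (\<lambda>x. Some (X x))))" by (simp add: closed_operator_def)
  show "complex_vector.subspace (Map.graph (?S \<circ>\<^sub>m (\<lambda>x. Some (X x))))"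
    using cl by (intro graph_subspace(1)) (simp add: closed_operator_def)
  show "complex_vector.subspace (Map.graph ((\<lambda>x. Some (X x)) \<circ>\<^sub>m ?S))"
    by (intro graph_subspace(1) linear_operator_comp linear_operator_blinfun XC quotient_linear)
  show "Map.graph ((\<lambda>x. Some (X x)) \<circ>\<^sub>m ?S) \<subseteq> Map.graph (?S \<circ>\<^sub>m (\<lambda>x. Some (X x)))"
    unfolding graph_comp_quotient
    by (rule image_subsetI) (simp add: in_graph_iff comp_blinfun_right Xc Xs quotient_at_range)
  fix p assume p: "p \<in> Map.graph (?S \<circ>\<^sub>m (\<lambda>x. Some (X x)))"
    and orth: "\<And>m. m \<in> Map.graph ((\<lambda>x. Some (X x)) \<circ>\<^sub>m ?S) \<Longrightarrow> cinner p m = 0"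
  obtain x u where xu: "p = (x, s u)" "X x = c u"
    using p by (cases p) (auto simp: in_graph_iff comp_blinfun_right quotient_Some)
  have "(c (c x), X (s (c x))) \<in> Map.graph ((\<lambda>x. Some (X x)) \<circ>\<^sub>m ?S)"
    unfolding graph_comp_quotient by blast
  then have "cinner x (c (c x)) + cinner (s u) (X (s (c x))) = 0" using orth xu(1) by fastforce
  moreover have "cinner x (c (c x)) = cinner (c x) (c x)" by (simp add: adjD[OF adj_c])
  moreover have "X (s (c x)) = c (c (s u))" by (simp add: Xc Xs xu(2) cs)
  then have "cinner (s u) (X (s (c x))) = cinner (c (s u)) (c (s u))" by (simp add: adjD[OF adj_c])
  ultimately have "Re (cinner (c x) (c x)) + Re (cinner (c (s u)) (c (s u))) = 0"
    by (metis plus_complex.sel(1) zero_complex.sel(1))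
  then have "(norm (c x))\<^sup>2 + (norm (c (s u)))\<^sup>2 = 0" by (simp only: Re_cinner_self)
  then have "c x = 0" "c (s u) = 0" by (simp_all add: sum_power2_eq_zero_iff)
  then show "p = 0" using c_inj by (simp add: xu(1) zero_prod_def)
qed

lemma commuting_product_core:
  assumes "\<And>a x. blinfun_apply X (a *\<^sub>C x) = a *\<^sub>C X x"
    and "\<And>x. X (c x) = c (X x)" and "\<And>x. X (s x) = s (X x)"
  shows "Map.graph (quotient_operator c s \<circ>\<^sub>m (\<lambda>x. Some (X x))) =
    closure (range (\<lambda>u. (c u, X (s u))))"
  using commuting_product_closure[OF assms] unfolding graph_comp_quotient by simp

text \<open>
  As \<open>S b\<close> is the closure of \<open>b S\<close>, its adjoint and the sign of its form can be computed on the pairs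
  \<open>(c u, b s u)\<close>: the adjoint is given by \<open>s b y = c z\<close>, which is \<open>z = S b y\<close>, and the form is
  \<open>\<langle>c s b u, u\<rangle>\<close> for a product of three commuting nonnegative operators.
\<close>

lemma commuting_product_self_adjoint:
  assumes b: "nonneg_op b" and bc: "\<And>x. b (c x) = c (b x)" and bs: "\<And>x. b (s x) = s (b x)"
  shows "self_adjoint (quotient_operator c s \<circ>\<^sub>m (\<lambda>x. Some (b x)))"
    and "positive_operator (quotient_operator c s \<circ>\<^sub>m (\<lambda>x. Some (b x)))"
proof -
  let ?P = "quotient_operator c s \<circ>\<^sub>m (\<lambda>x. Some (b x))"
  note ab = nonneg_opD(1)[OF b] and bC = adj_scaleC[OF nonneg_opD(1)[OF b]]
  note core = commuting_product_core[OF bC bc bs]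
  have lin: "linear_operator ?P"
    using closed_operator_comp_blinfun[OF quotient_closed bC] by (simp add: closed_operator_def)
  have at_range: "?P (c u) = Some (b (s u))" for u
    by (simp add: comp_blinfun_right bc bs quotient_at_range)
  have dd: "densely_defined ?P"
  proof -
    have "range (blinfun_apply c) \<subseteq> dom ?P" using at_range by blast
    then have "closure (range (blinfun_apply c)) \<subseteq> closure (dom ?P)" by (rule closure_mono)
    then show ?thesis using range_c_dense by (auto simp: densely_defined_def)
  qed
  \<comment> \<open>\<open>Q\<close> is a closed condition on pairs; it suffices to check it on the core\<close>
  have graph_induct: "Q (x, w)"
    if "closed {p. Q p}" "\<And>u. Q (c u, b (s u))" "?P x = Some w" for Q x w
  proof -
    have "closure (range (\<lambda>u. (c u, b (s u)))) \<subseteq> {p. Q p}"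
      using that(1,2) by (intro closure_minimal) auto
    then show ?thesis using that(3) core by (auto simp: in_graph_iff[symmetric])
  qed
  have adj_iff: "adjoint_operator ?P y = Some z \<longleftrightarrow> s (b y) = c z" for y z
  proof
    assume "adjoint_operator ?P y = Some z"
    then have "cinner (b (s u)) y = cinner (c u) z" for u
      using at_range unfolding adjoint_Some[OF dd] by blast
    then show "s (b y) = c z"
      by (intro cinner_eqI_right) (simp add: adjD[OF ab] adjD[OF adj_s] adjD[OF adj_c])
  next
    assume eq: "s (b y) = c z"
    show "adjoint_operator ?P y = Some z"
      unfolding adjoint_Some[OF dd]
    proof (intro allI impI)
      fix x w assume "?P x = Some w"
      then have "case_prod (\<lambda>x w. cinner w y = cinner x z) (x, w)"
      proof (rule graph_induct[rotated 2])
        show "closed {p. case_prod (\<lambda>x w. cinner w y = cinner x z) p}"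
          unfolding case_prod_beta by (intro closed_Collect_eq continuous_intros)
        show "case_prod (\<lambda>x w. cinner w y = cinner x z) (c u, b (s u))" for u
          by (simp add: adjD[OF ab] adjD[OF adj_s] adjD[OF adj_c] eq)
      qed
      then show "cinner w y = cinner x z" by simp
    qed
  qed
  show "self_adjoint ?P"
    unfolding self_adjoint_def
    by (intro conjI lin dd map_eqI) (simp add: adj_iff comp_blinfun_right quotient_Some_iff)
  have "nonneg_op (s o\<^sub>L b)" by (rule nonneg_compose[OF s b s_near_id]) (simp add: bs)
  then have csb: "nonneg_op (c o\<^sub>L (s o\<^sub>L b))"
    by (rule nonneg_compose[OF c _ c_near_id]) (simp add: bc cs)
  show "positive_operator ?P"
    unfolding positive_operator_def
  proof (intro conjI lin ballI)
    fix x assume "x \<in> dom ?P"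
    then obtain w where w: "?P x = Some w" by blast
    then have "case_prod (\<lambda>x w. cinner w x \<in> \<real>\<^sub>\<ge>\<^sub>0) (x, w)"
    proof (rule graph_induct[rotated 2])
      have "closed ((\<lambda>p. cinner (snd p) (fst p)) -` \<real>\<^sub>\<ge>\<^sub>0 :: ('a \<times> 'a) set)"
        by (intro closed_vimage closed_nonneg_Reals_complex continuous_intros)
      then show "closed {p. case_prod (\<lambda>x w :: 'a. cinner w x \<in> \<real>\<^sub>\<ge>\<^sub>0) p}"
        by (simp add: vimage_def case_prod_beta)
      fix u
      have "cinner (b (s u)) (c u) = cinner ((c o\<^sub>L (s o\<^sub>L b)) u) u"
        by (simp add: adjD[OF adj_c] bs)
      then show "case_prod (\<lambda>x w. cinner w x \<in> \<real>\<^sub>\<ge>\<^sub>0) (c u, b (s u))"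
        using nonneg_op_cinner[OF csb, of u] by simp
    qed
    then show "cinner (the (?P x)) x \<in> \<real>\<^sub>\<ge>\<^sub>0" using w by simp
  qed
qed

text \<open>
  On the common core \<open>range c\<close> the products \<open>S X\<close> and \<open>S Y\<close> take the values \<open>X (s u)\<close> and \<open>Y (s u)\<close>, of equal norm.
\<close>

lemma commuting_product_norm_mono:
  assumes X: "\<And>a x. blinfun_apply X (a *\<^sub>C x) = a *\<^sub>C X x"
      "\<And>x. X (c x) = c (X x)" "\<And>x. X (s x) = s (X x)"
    and Y: "\<And>a x. blinfun_apply Y (a *\<^sub>C x) = a *\<^sub>C Y x"
      "\<And>x. Y (c x) = c (Y x)" "\<And>x. Y (s x) = s (Y x)"
    and XY: "\<And>x. norm (X x) = norm (Y x)"
    and x: "quotient_operator c s (X x) = Some a"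
  shows "\<exists>b. quotient_operator c s (Y x) = Some b \<and> norm b = norm a"
proof -
  let ?S = "quotient_operator c s"
  have "\<exists>b. (?S \<circ>\<^sub>m (\<lambda>x. Some (Y x))) x = Some b \<and> norm b = norm a"
  proof (rule same_norm_on_core)
    show "closed_operator (?S \<circ>\<^sub>m (\<lambda>x. Some (X x)))" "closed_operator (?S \<circ>\<^sub>m (\<lambda>x. Some (Y x)))"
      by (intro closed_operator_comp_blinfun quotient_closed X Y)+
    have "range (\<lambda>u. (c u, X (s u))) \<subseteq>
      {(x, a). (?S \<circ>\<^sub>m (\<lambda>x. Some (X x))) x = Some a \<and> x \<in> range (blinfun_apply c)}"
      by (auto simp: comp_blinfun_right X quotient_at_range)
    then show "Map.graph (?S \<circ>\<^sub>m (\<lambda>x. Some (X x))) \<subseteq>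
      closure {(x, a). (?S \<circ>\<^sub>m (\<lambda>x. Some (X x))) x = Some a \<and> x \<in> range (blinfun_apply c)}"
      unfolding commuting_product_core[OF X] by (rule closure_mono)
    show "x - y \<in> range (blinfun_apply c)"
      if "x \<in> range (blinfun_apply c)" "y \<in> range (blinfun_apply c)" for x y
      using that by (auto simp: image_iff blinfun.diff_right[symmetric])
    show "(?S \<circ>\<^sub>m (\<lambda>x. Some (X x))) x = Some a" using x by (simp add: comp_blinfun_right)
    fix x a assume "x \<in> range (blinfun_apply c)" "(?S \<circ>\<^sub>m (\<lambda>x. Some (X x))) x = Some a"
    then obtain u where "x = c u" "a = X (s u)"
      by (auto simp: comp_blinfun_right X quotient_at_range)
    then show "\<exists>b. (?S \<circ>\<^sub>m (\<lambda>x. Some (Y x))) x = Some b \<and> norm b = norm a"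
      by (simp add: comp_blinfun_right Y quotient_at_range XY[symmetric] del: Y(3))
        (simp add: Y(3)[symmetric] XY)
  qed
  then show ?thesis by (simp add: comp_blinfun_right)
qed

end

text \<open>By polarization \<open>\<parallel>T x\<parallel>\<close> determines the sesquilinear form \<open>\<langle>T x, T y\<rangle>\<close>, which defines \<open>T\<^sup>* T\<close>.\<close>

lemma adjoint_square_cong:
  assumes lin: "linear_operator T1" "linear_operator T2" and dd: "densely_defined T1" "densely_defined T2"
    and 12: "\<And>x a. T1 x = Some a \<Longrightarrow> \<exists>b. T2 x = Some b \<and> norm b = norm a"
    and 21: "\<And>x a. T2 x = Some a \<Longrightarrow> \<exists>b. T1 x = Some b \<and> norm b = norm a"
  shows "adjoint_operator T1 \<circ>\<^sub>m T1 = adjoint_operator T2 \<circ>\<^sub>m T2"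
proof -
  have inner: "cinner a a' = cinner b b'"
    if T: "T1 x = Some a" "T1 y = Some a'" "T2 x = Some b" "T2 y = Some b'" for x y a a' b b'
  proof -
    have n: "norm a = norm b" if "T1 x = Some a" "T2 x = Some b" for x a b
      using 12[OF that(1)] that(2) by auto
    have Re: "Re (cinner a a') = Re (cinner b b')"
      if T: "T1 x = Some a" "T1 y = Some a'" "T2 x = Some b" "T2 y = Some b'" for x y a a' b b'
      using n[OF linear_operatorD(1)[OF lin(1) T(1,2)] linear_operatorD(1)[OF lin(2) T(3,4)]]
        n[OF T(1,3)] n[OF T(2,4)] norm_add_sq[of a a'] norm_add_sq[of b b'] by simp
    have "Re (cinner (\<i> *\<^sub>C a) a') = Re (cinner (\<i> *\<^sub>C b) b')"
      by (rule Re[OF linear_operatorD(2)[OF lin(1) T(1)] T(2)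
          linear_operatorD(2)[OF lin(2) T(3)] T(4)])
    then show ?thesis using Re[OF T] by (simp add: complex_eq_iff cinner_simps)
  qed
  have imp: "(adjoint_operator T \<circ>\<^sub>m T) x = Some z"
    if dd: "densely_defined T" "densely_defined T'"
      and ex: "\<And>x a. T' x = Some a \<Longrightarrow> \<exists>b. T x = Some b" "\<And>x a. T x = Some a \<Longrightarrow> \<exists>b. T' x = Some b"
      and inner: "\<And>x y a a' b b'. T x = Some a \<Longrightarrow> T y = Some a' \<Longrightarrow> T' x = Some b \<Longrightarrow> T' y = Some b' \<Longrightarrow>
        cinner a a' = cinner b b'"
      and x: "(adjoint_operator T' \<circ>\<^sub>m T') x = Some z" for T T' x z
  proof -
    obtain b where b: "T' x = Some b" "\<And>y b'. T' y = Some b' \<Longrightarrow> cinner b' b = cinner y z"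
      using x unfolding map_comp_Some_iff adjoint_Some[OF dd(2)] by blast
    obtain a where a: "T x = Some a" using ex(1)[OF b(1)] by blast
    have "cinner a' a = cinner y z" if y: "T y = Some a'" for y a'
    proof -
      obtain b' where b': "T' y = Some b'" using ex(2)[OF y] by blast
      show ?thesis using inner[OF y a b' b(1)] b(2)[OF b'] by simp
    qed
    then show ?thesis using a unfolding map_comp_Some_iff adjoint_Some[OF dd(1)] by blast
  qed
  have ex12: "\<exists>b. T2 x = Some b" if "T1 x = Some a" for x a using 12[OF that] by blast
  have ex21: "\<exists>b. T1 x = Some b" if "T2 x = Some a" for x a using 21[OF that] by blast
  have inner': "cinner b b' = cinner a a'"
    if "T2 x = Some b" "T2 y = Some b'" "T1 x = Some a" "T1 y = Some a'" for x y a a' b b'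
    using inner[OF that(3,4,1,2)] by simp
  show ?thesis
  proof (rule map_eqI, rule iffI)
    fix x z
    show "(adjoint_operator T2 \<circ>\<^sub>m T2) x = Some z" if "(adjoint_operator T1 \<circ>\<^sub>m T1) x = Some z"
      by (rule imp[OF dd(2,1) ex12 ex21 inner' that])
    show "(adjoint_operator T1 \<circ>\<^sub>m T1) x = Some z" if "(adjoint_operator T2 \<circ>\<^sub>m T2) x = Some z"
      by (rule imp[OF dd ex21 ex12 inner that])
  qed
qed

section \<open>The absolute value of the product\<close>

theorem theorem2p4:
  fixes A B :: "'a::complex_hilbert_space \<rightharpoonup> 'a"
  assumes "normal_operator A"
    and "bounded_operator B"
    and "B \<circ>\<^sub>m A \<subseteq>\<^sub>m A \<circ>\<^sub>m B"
  shows "closable (B \<circ>\<^sub>m A) \<and>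
    densely_defined (A \<circ>\<^sub>m B) \<and> closed_operator (A \<circ>\<^sub>m B) \<and>
    closable (operator_abs B \<circ>\<^sub>m operator_abs A) \<and>
    operator_abs (operator_closure (B \<circ>\<^sub>m A)) = operator_abs (A \<circ>\<^sub>m B) \<and>
    operator_abs (A \<circ>\<^sub>m B) = operator_abs A \<circ>\<^sub>m operator_abs B \<and>
    operator_abs A \<circ>\<^sub>m operator_abs B =
      operator_closure (operator_abs B \<circ>\<^sub>m operator_abs A)"
proof -
  have clA: "closed_operator A" and ddA: "densely_defined A"
    using assms(1) by (auto simp: normal_operator_def)
  then have linA: "linear_operator A" by (simp add: closed_operator_def)
  obtain X where B: "B = (\<lambda>x. Some (blinfun_apply X x))" and XC: "\<And>a x. X (a *\<^sub>C x) = a *\<^sub>C X x"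
    using bounded_operatorE[OF assms(2)] by blast
  obtain X' where X': "adj X X'" using adj_exists[OF XC] by blast
  have XA: "A (X x) = Some (X a)" if "A x = Some a" for x a
  proof -
    have "(B \<circ>\<^sub>m A) x = Some (X a)" using that by (simp add: B comp_blinfun_left)
    then have "(A \<circ>\<^sub>m B) x = Some (X a)" using assms(3) by (metis domI map_le_def)
    then show ?thesis by (simp add: B comp_blinfun_right)
  qed
  obtain c s where rep: "cos_sin c s" and sub: "subordinate c (c o\<^sub>L c)" "subordinate s (c o\<^sub>L c)"
    and res: "resolvent_of (adjoint_operator A \<circ>\<^sub>m A) (c o\<^sub>L c)"
    and absA: "operator_abs A = quotient_operator c s"
    using operator_abs_representation[OF clA ddA] by blast
  interpret cos_sin c s by (rule rep)
  let ?S = "quotient_operator c s"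
  have Xcc: "X ((c o\<^sub>L c) x) = (c o\<^sub>L c) (X x)" for x
    using commutes_with_resolvent_of_normal[OF assms(1) rep sub(1) res X' XA] by simp
  have X'cc: "X' ((c o\<^sub>L c) x) = (c o\<^sub>L c) (X' x)" for x
  proof (rule cinner_eqI_right)
    fix y
    have "cinner y (X' ((c o\<^sub>L c) x)) = cinner ((c o\<^sub>L c) (X y)) x"
      by (simp add: adjD[OF X', symmetric] adjD[OF adj_c])
    also have "\<dots> = cinner (X ((c o\<^sub>L c) y)) x" by (simp only: Xcc)
    also have "\<dots> = cinner y ((c o\<^sub>L c) (X' x))" by (simp add: adjD[OF X'] adjD[OF adj_c])
    finally show "cinner y (X' ((c o\<^sub>L c) x)) = cinner y ((c o\<^sub>L c) (X' x))" .
  qed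
  have Xc: "X (c x) = c (X x)" and Xs: "X (s x) = s (X x)"
    and X'c: "X' (c x) = c (X' x)" and X's: "X' (s x) = s (X' x)" for x
    by (rule subordinate_commutes[OF sub(1) Xcc] subordinate_commutes[OF sub(2) Xcc]
        subordinate_commutes[OF sub(1) X'cc] subordinate_commutes[OF sub(2) X'cc])+
  obtain b where b: "nonneg_op b" "b o\<^sub>L b = X' o\<^sub>L X"
    and bZ: "\<And>(Z :: 'a \<Rightarrow>\<^sub>L 'a) x. (\<And>x. Z (X' (X x)) = X' (X (Z x))) \<Longrightarrow> Z (b x) = b (Z x)"
    using bounded_abs_exists[OF X'] by blast
  have bc: "b (c x) = c (b x)" and bs: "b (s x) = s (b x)" for x
    by (rule bZ[symmetric]; simp add: Xc Xs X'c X's)+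
  note ab = nonneg_opD(1)[OF b(1)]
  note bC = adj_scaleC[OF ab]
  have bb: "b (b x) = X' (X x)" for x using b(2) by (metis blinfun_apply_blinfun_compose)
  have absB: "operator_abs B = (\<lambda>x. Some (b x))"
  proof (rule operator_abs_eqI)
    show "self_adjoint (\<lambda>x. Some (b x))"
      by (simp add: self_adjoint_def linear_operator_blinfun[OF bC] densely_defined_def dom_def
          adjoint_blinfun[OF ab])
    show "positive_operator (\<lambda>x. Some (b x))"
      by (simp add: positive_operator_def linear_operator_blinfun[OF bC] nonneg_op_cinner[OF b(1)])
    show "(\<lambda>x. Some (b x)) \<circ>\<^sub>m (\<lambda>x. Some (b x)) = adjoint_operator B \<circ>\<^sub>m B"
      by (rule ext) (simp add: B adjoint_blinfun[OF X'] bb)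
  qed
  have Xb: "norm (X x) = norm (b x)" for x
  proof -
    have "(norm (X x))\<^sup>2 = (norm (b x))\<^sup>2" unfolding norm_sq_adj[OF X'] norm_sq_adj[OF ab] bb ..
    then show ?thesis by simp
  qed
  have hA: "has_resolvent A (c o\<^sub>L c)" by (rule has_resolventI[OF ddA res])
  note AS = same_resolvent_same_norm[OF clA hA quotient_closed quotient_has_resolvent cc_scaleC]
  note SA = same_resolvent_same_norm[OF quotient_closed quotient_has_resolvent clA hA cc_scaleC]

  have clAB: "closed_operator (A \<circ>\<^sub>m B)"
    unfolding B by (rule closed_operator_comp_blinfun[OF clA XC])
  then have linAB: "linear_operator (A \<circ>\<^sub>m B)" by (simp add: closed_operator_def)
  have ddAB: "densely_defined (A \<circ>\<^sub>m B)"
  proof -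
    have "dom A \<subseteq> dom (A \<circ>\<^sub>m B)" using XA by (auto simp: dom_def B comp_blinfun_right)
    then show ?thesis using ddA closure_mono unfolding densely_defined_def by blast
  qed

  \<comment> \<open>\<open>A\<close> and \<open>S = \<bar>A\<bar>\<close> have the same domain and norms, so graph limits for \<open>X S\<close> are graph limits for \<open>B A\<close>\<close>
  have closBA: "closure (Map.graph (B \<circ>\<^sub>m A)) = Map.graph (A \<circ>\<^sub>m B)"
  proof
    have "Map.graph (B \<circ>\<^sub>m A) \<subseteq> Map.graph (A \<circ>\<^sub>m B)"
      using XA by (auto simp: in_graph_iff B comp_blinfun_left comp_blinfun_right)
    then show "closure (Map.graph (B \<circ>\<^sub>m A)) \<subseteq> Map.graph (A \<circ>\<^sub>m B)"
      using clAB by (intro closure_minimal) (auto simp: closed_operator_def)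
    show "Map.graph (A \<circ>\<^sub>m B) \<subseteq> closure (Map.graph (B \<circ>\<^sub>m A))"
    proof clarify
      fix x a assume "(x, a) \<in> Map.graph (A \<circ>\<^sub>m B)"
      then have xa: "A (X x) = Some a" by (simp add: in_graph_iff B comp_blinfun_right)
      then obtain w where w: "?S (X x) = Some w" using AS by blast
      then have "(x, w) \<in> closure (range (\<lambda>u. (c u, X (s u))))"
        unfolding commuting_product_core[OF XC Xc Xs, symmetric] by (simp add: in_graph_iff comp_blinfun_right)
      then obtain f where f: "\<And>n. f n \<in> range (\<lambda>u. (c u, X (s u)))" "f \<longlonglongrightarrow> (x, w)"
        unfolding closure_sequential by blast
      have "\<exists>u. f n = (c u, X (s u))" for n using f(1)[of n] by blast
      then obtain u where u: "\<And>n. f n = (c (u n), X (s (u n)))" by metis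
      have lim: "(\<lambda>n. c (u n)) \<longlonglongrightarrow> x" "(\<lambda>n. X (s (u n))) \<longlonglongrightarrow> w"
        using tendsto_fst[OF f(2)] tendsto_snd[OF f(2)] by (simp_all add: u)
      have "\<exists>d. A (c (u n)) = Some d" for n using SA[OF quotient_at_range] by blast
      then obtain d where d: "\<And>n. A (c (u n)) = Some (d n)" by metis
      have dist: "norm (X (d n) - a) = norm (X (s (u n)) - w)" for n
      proof -
        have "A (X (c (u n)) - X x) = Some (X (d n) - a)"
          by (rule linear_operatorD(4)[OF linA XA[OF d] xa])
        moreover have "?S (X (c (u n)) - X x) = Some (X (s (u n)) - w)"
          using linear_operatorD(4)[OF quotient_linear quotient_at_range w, of "X (u n)"]
          by (simp add: Xc Xs)
        ultimately show ?thesis using AS by fastforce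
      qed
      have "(\<lambda>n. X (s (u n)) - w) \<longlonglongrightarrow> 0" using lim(2) by (rule LIM_zero)
      then have "(\<lambda>n. X (d n) - a) \<longlonglongrightarrow> 0"
        unfolding tendsto_norm_zero_iff[symmetric, of "\<lambda>n. X (d n) - a"] dist by (rule tendsto_norm_zero)
      then have "(\<lambda>n. X (d n)) \<longlonglongrightarrow> a" by (rule LIM_zero_cancel)
      then have "(\<lambda>n. (c (u n), X (d n))) \<longlonglongrightarrow> (x, a)" using lim(1) by (intro tendsto_Pair)
      moreover have "(c (u n), X (d n)) \<in> Map.graph (B \<circ>\<^sub>m A)" for n
        using d by (auto simp: in_graph_iff B comp_blinfun_left)
      ultimately show "(x, a) \<in> closure (Map.graph (B \<circ>\<^sub>m A))"
        unfolding closure_sequential by (intro exI[of _ "\<lambda>n. (c (u n), X (d n))"]) blast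
    qed
  qed
  have linBA: "linear_operator (B \<circ>\<^sub>m A)"
    unfolding B by (intro linear_operator_comp linear_operator_blinfun XC linA)

  let ?P = "?S \<circ>\<^sub>m (\<lambda>x. Some (b x))"
  note P = commuting_product_self_adjoint[OF b(1) bc bs]
  note saP = self_adjointD[OF P(1)]
  have "adjoint_operator ?P \<circ>\<^sub>m ?P = adjoint_operator (A \<circ>\<^sub>m B) \<circ>\<^sub>m (A \<circ>\<^sub>m B)"
  proof (rule adjoint_square_cong[OF saP(3) linAB saP(2) ddAB])
    show "\<exists>d. (A \<circ>\<^sub>m B) x = Some d \<and> norm d = norm a" if "?P x = Some a" for x a
      using commuting_product_norm_mono[OF bC bc bs XC Xc Xs Xb[symmetric], of x a] SA that
      by (fastforce simp: B comp_blinfun_right)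
    show "\<exists>d. ?P x = Some d \<and> norm d = norm a" if "(A \<circ>\<^sub>m B) x = Some a" for x a
      using commuting_product_norm_mono[OF XC Xc Xs bC bc bs Xb, of x] AS[of "X x" a] that
      by (fastforce simp: B comp_blinfun_right)
  qed
  then have absAB: "operator_abs (A \<circ>\<^sub>m B) = ?P"
    using P saP(4) by (intro operator_abs_eqI) simp_all
  note closS = commuting_product_closure[OF bC bc bs]
  have linbS: "linear_operator ((\<lambda>x. Some (b x)) \<circ>\<^sub>m ?S)"
    by (intro linear_operator_comp linear_operator_blinfun bC quotient_linear)
  show ?thesis
    unfolding absAB absA absB operator_closure_eq[OF closBA] operator_closure_eq[OF closS]
    using closableI[OF linBA closBA] ddAB clAB closableI[OF linbS closS] by simp
qed

end
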